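(* Let $K$ be a field. As a $2$-$As$ algebra over $K$, $(\mathcal{H}_{\mathcal{WNP}},\rightsquigarrow,\natural)$ is freely generated by the single element $\bullet$, the one-element plane poset.
   Context: A double poset is a triple $(P,\leq_1,\leq_2)$ where $P$ is a finite set and $\leq_1,\leq_2$ are two partial orders on $P$; double posets are considered up to isomorphism, and the empty one is denoted $1$. A plane poset is a double poset $(P,\leq_h,\leq_r)$ (with $\leq_h=\leq_1$, $\leq_r=\leq_2$) such that for all $x\neq y$ in $P$, $x$ and $y$ are comparable for $\leq_h$ if and only if they are not comparable for $\leq_r$. Let $N_1$ and $N_2$ be the following plane posets on $\{a,b,c,d\}$ (listing all strict relations): $N_1$: $a<_h c$, $a<_h d$, $b<_h d$; $a<_r b$, $c<_r b$, $c<_r d$. $N_2$: $a<_h c$, $b<_h c$, $b<_h d$; $a<_r b$, $a<_r d$, $c<_r d$. A double poset is WN ("without N") if it is plane and has no subposet (subset with the restricted orders) isomorphic to $N_1$ or $N_2$. $\mathcal{WNP}$ is the set of isomorphism classes of WN posets. For double posets $P,Q$: $P\rightsquigarrow Q$ is the disjoint union of $P$ and $Q$, with $P$ and $Q$ as double subposets, and for all $x\in P$, $y\in Q$: $x\leq_2 y$ and $x,y$ are not comparable for $\leq_1$. Similarly $P\natural Q$ is the disjoint union of $P$ and $Q$, with $P$ and $Q$ as double subposets, and for all $x\in P$, $y\in Q$: $x\leq_1 y$ and $x,y$ are not comparable for $\leq_2$. Both products are associative with unit $1$, and products of WN posets are WN. $\mathcal{H}_{\mathcal{WNP}}$ is the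 $K$-vector space with basis $\mathcal{WNP}$, with $\rightsquigarrow$ and $\natural$ extended bilinearly. A $2$-$As$ algebra is a $K$-vector space with two associative products sharing the same unit; morphisms preserve both products and the unit; "freely generated by $\bullet$" means that for every $2$-$As$ algebra $A$ and every $a\in A$ there is a unique morphism of $2$-$As$ algebras to $A$ sending $\bullet$ to $a$. *)

theory Defs
  imports Complex_Main "HOL-Library.Poly_Mapping" "HOL-Library.Nat_Bijection"
begin

section \<open>Double posets\<close>

datatype 'a dposet = DPoset (verts: "'a set") (le1: "'a rel") (le2: "'a rel")

definition double_poset :: "'a dposet \<Rightarrow> bool" where
  "double_poset P \<longleftrightarrow> finite (verts P) \<and>
     partial_order_on (verts P) (le1 P) \<and> partial_order_on (verts P) (le2 P)"

definition comparable :: "'a rel \<Rightarrow> 'a \<Rightarrow> 'a \<Rightarrow> bool" where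
  "comparable r x y \<longleftrightarrow> (x, y) \<in> r \<or> (y, x) \<in> r"

definition plane_poset :: "'a dposet \<Rightarrow> bool" where
  "plane_poset P \<longleftrightarrow> double_poset P \<and>
     (\<forall>x\<in>verts P. \<forall>y\<in>verts P. x \<noteq> y \<longrightarrow>
        (comparable (le1 P) x y \<longleftrightarrow> \<not> comparable (le2 P) x y))"

definition subposet :: "'a dposet \<Rightarrow> 'a set \<Rightarrow> 'a dposet" where
  "subposet P S = DPoset S (le1 P \<inter> S \<times> S) (le2 P \<inter> S \<times> S)"

definition dp_iso :: "'a dposet \<Rightarrow> 'b dposet \<Rightarrow> bool" where
  "dp_iso P Q \<longleftrightarrow> (\<exists>f. bij_betw f (verts P) (verts Q) \<and>
     (\<forall>x\<in>verts P. \<forall>y\<in>verts P.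
        ((x, y) \<in> le1 P \<longleftrightarrow> (f x, f y) \<in> le1 Q) \<and>
        ((x, y) \<in> le2 P \<longleftrightarrow> (f x, f y) \<in> le2 Q)))"

text \<open>In the next two definitions the points \<open>a, b, c, d\<close> are encoded as \<open>0, 1, 2, 3\<close>.\<close>

definition N1 :: "nat dposet" where
  "N1 = DPoset {0, 1, 2, 3}
     (Id_on {0, 1, 2, 3} \<union> {(0, 2), (0, 3), (1, 3)})
     (Id_on {0, 1, 2, 3} \<union> {(0, 1), (2, 1), (2, 3)})"

definition N2 :: "nat dposet" where
  "N2 = DPoset {0, 1, 2, 3}
     (Id_on {0, 1, 2, 3} \<union> {(0, 2), (1, 2), (1, 3)})
     (Id_on {0, 1, 2, 3} \<union> {(0, 1), (0, 3), (2, 3)})"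

definition wn_poset :: "'a dposet \<Rightarrow> bool" where
  "wn_poset P \<longleftrightarrow> plane_poset P \<and>
     \<not> (\<exists>S \<subseteq> verts P. dp_iso (subposet P S) N1 \<or> dp_iso (subposet P S) N2)"

definition sum_rel :: "'a rel \<Rightarrow> 'b rel \<Rightarrow> ('a + 'b) rel" where
  "sum_rel r s = map_prod Inl Inl ` r \<union> map_prod Inr Inr ` s"

definition dp_leadsto :: "'a dposet \<Rightarrow> 'b dposet \<Rightarrow> ('a + 'b) dposet" where
  "dp_leadsto P Q = DPoset (verts P <+> verts Q)
     (sum_rel (le1 P) (le1 Q))
     (sum_rel (le2 P) (le2 Q) \<union> (Inl ` verts P) \<times> (Inr ` verts Q))"

definition dp_natural :: "'a dposet \<Rightarrow> 'b dposet \<Rightarrow> ('a + 'b) dposet" where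
  "dp_natural P Q = DPoset (verts P <+> verts Q)
     (sum_rel (le1 P) (le1 Q) \<union> (Inl ` verts P) \<times> (Inr ` verts Q))
     (sum_rel (le2 P) (le2 Q))"

definition dp_image :: "('a \<Rightarrow> 'b) \<Rightarrow> 'a dposet \<Rightarrow> 'b dposet" where
  "dp_image f P = DPoset (f ` verts P) (map_prod f f ` le1 P) (map_prod f f ` le2 P)"

lemma dposet_sel_simps [simp]:
  "verts (subposet P S) = S"
  "le1 (subposet P S) = le1 P \<inter> S \<times> S"
  "le2 (subposet P S) = le2 P \<inter> S \<times> S"
  "verts (dp_image f P) = f ` verts P"
  "le1 (dp_image f P) = map_prod f f ` le1 P"
  "le2 (dp_image f P) = map_prod f f ` le2 P"
  "verts (dp_leadsto P Q) = verts P <+> verts Q"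
  "le1 (dp_leadsto P Q) = sum_rel (le1 P) (le1 Q)"
  "le2 (dp_leadsto P Q) = sum_rel (le2 P) (le2 Q) \<union> (Inl ` verts P) \<times> (Inr ` verts Q)"
  "verts (dp_natural P Q) = verts P <+> verts Q"
  "le1 (dp_natural P Q) = sum_rel (le1 P) (le1 Q) \<union> (Inl ` verts P) \<times> (Inr ` verts Q)"
  "le2 (dp_natural P Q) = sum_rel (le2 P) (le2 Q)"
  by (simp_all add: subposet_def dp_image_def dp_leadsto_def dp_natural_def)

lemma sum_rel_simps [simp]:
  "(Inl x, Inl y) \<in> sum_rel r s \<longleftrightarrow> (x, y) \<in> r"
  "(Inr u, Inr v) \<in> sum_rel r s \<longleftrightarrow> (u, v) \<in> s"
  "(Inl x, Inr v) \<notin> sum_rel r s"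
  "(Inr u, Inl y) \<notin> sum_rel r s"
  by (auto simp: sum_rel_def)

lemma Plus_iff [simp]: "Inl a \<in> A <+> B \<longleftrightarrow> a \<in> A" "Inr b \<in> A <+> B \<longleftrightarrow> b \<in> B"
  by auto

lemma map_prod_image_iff:
  "inj f \<Longrightarrow> (f x, f y) \<in> map_prod f f ` r \<longleftrightarrow> (x, y) \<in> r"
  by (auto simp: inj_def)


subsection \<open>Isomorphism is an equivalence\<close>

lemma dp_iso_refl: "dp_iso P P"
  unfolding dp_iso_def by (rule exI[of _ id]) auto

lemma dp_iso_sym:
  assumes "dp_iso P Q" shows "dp_iso Q P"
proof -
  obtain f where f: "bij_betw f (verts P) (verts Q)"
    "\<And>x y. x \<in> verts P \<Longrightarrow> y \<in> verts P \<Longrightarrow>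
        ((x, y) \<in> le1 P \<longleftrightarrow> (f x, f y) \<in> le1 Q) \<and>
        ((x, y) \<in> le2 P \<longleftrightarrow> (f x, f y) \<in> le2 Q)"
    using assms unfolding dp_iso_def by blast
  let ?g = "inv_into (verts P) f"
  have g: "?g x \<in> verts P" "f (?g x) = x" if "x \<in> verts Q" for x
    using f(1) that by (auto simp: bij_betw_def inv_into_into f_inv_into_f)
  show ?thesis unfolding dp_iso_def
    by (rule exI[of _ ?g]) (use f g in \<open>auto simp: bij_betw_inv_into\<close>)
qed

lemma dp_iso_trans:
  assumes "dp_iso P Q" "dp_iso Q R" shows "dp_iso P R"
proof -
  obtain f where f: "bij_betw f (verts P) (verts Q)"
    "\<And>x y. x \<in> verts P \<Longrightarrow> y \<in> verts P \<Longrightarrow>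
        ((x, y) \<in> le1 P \<longleftrightarrow> (f x, f y) \<in> le1 Q) \<and>
        ((x, y) \<in> le2 P \<longleftrightarrow> (f x, f y) \<in> le2 Q)"
    using assms(1) unfolding dp_iso_def by blast
  obtain g where g: "bij_betw g (verts Q) (verts R)"
    "\<And>x y. x \<in> verts Q \<Longrightarrow> y \<in> verts Q \<Longrightarrow>
        ((x, y) \<in> le1 Q \<longleftrightarrow> (g x, g y) \<in> le1 R) \<and>
        ((x, y) \<in> le2 Q \<longleftrightarrow> (g x, g y) \<in> le2 R)"
    using assms(2) unfolding dp_iso_def by blast
  have "f x \<in> verts Q" if "x \<in> verts P" for x
    using f(1) that by (auto simp: bij_betw_def)
  then show ?thesis unfolding dp_iso_def
    by (intro exI[of _ "g \<circ> f"]) (use f g in \<open>auto intro: bij_betw_trans\<close>)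
qed

lemma dp_iso_image: "inj f \<Longrightarrow> dp_iso P (dp_image f P)"
  unfolding dp_iso_def
  by (rule exI[of _ f]) (auto simp: map_prod_image_iff bij_betw_def inj_on_def)


subsection \<open>WN posets are closed under isomorphic images and both products\<close>

definition dp_embeds :: "'b dposet \<Rightarrow> 'a dposet \<Rightarrow> ('b \<Rightarrow> 'a) \<Rightarrow> bool" where
  "dp_embeds N P e \<longleftrightarrow> inj_on e (verts N) \<and> e ` verts N \<subseteq> verts P \<and>
     (\<forall>x\<in>verts N. \<forall>y\<in>verts N.
        ((x, y) \<in> le1 N \<longleftrightarrow> (e x, e y) \<in> le1 P) \<and>
        ((x, y) \<in> le2 N \<longleftrightarrow> (e x, e y) \<in> le2 P))"

lemma subposet_iso_iff_embeds:
  "(\<exists>S\<subseteq>verts P. dp_iso (subposet P S) N) \<longleftrightarrow> (\<exists>e. dp_embeds N P e)"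
proof
  assume "\<exists>S\<subseteq>verts P. dp_iso (subposet P S) N"
  then obtain S where S: "S \<subseteq> verts P" "dp_iso N (subposet P S)"
    using dp_iso_sym by blast
  then obtain f where f: "bij_betw f (verts N) S"
    "\<And>x y. x \<in> verts N \<Longrightarrow> y \<in> verts N \<Longrightarrow>
        ((x, y) \<in> le1 N \<longleftrightarrow> (f x, f y) \<in> le1 P \<inter> S \<times> S) \<and>
        ((x, y) \<in> le2 N \<longleftrightarrow> (f x, f y) \<in> le2 P \<inter> S \<times> S)"
    unfolding dp_iso_def by auto
  have "f x \<in> S" if "x \<in> verts N" for x
    using f(1) that by (auto simp: bij_betw_def)
  then have "dp_embeds N P f"
    using f S(1) unfolding dp_embeds_def by (auto simp: bij_betw_def)
  then show "\<exists>e. dp_embeds N P e" by blast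
next
  assume "\<exists>e. dp_embeds N P e"
  then obtain e where e: "dp_embeds N P e" by blast
  have "dp_iso N (subposet P (e ` verts N))"
    unfolding dp_iso_def
    by (rule exI[of _ e]) (use e in \<open>auto simp: dp_embeds_def bij_betw_def\<close>)
  then show "\<exists>S\<subseteq>verts P. dp_iso (subposet P S) N"
    using e dp_iso_sym by (intro exI[of _ "e ` verts N"]) (auto simp: dp_embeds_def)
qed

lemma wn_poset_iff_embeds:
  "wn_poset P \<longleftrightarrow> plane_poset P \<and> (\<nexists>e. dp_embeds N1 P e) \<and> (\<nexists>e. dp_embeds N2 P e)"
  unfolding wn_poset_def subposet_iso_iff_embeds[symmetric] by blast

lemma dp_embeds_factor:
  assumes e: "dp_embeds N Q e" and sub: "e ` verts N \<subseteq> f ` verts P" and f: "inj f"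
    and le: "\<And>x y. (f x, f y) \<in> le1 Q \<longleftrightarrow> (x, y) \<in> le1 P"
      "\<And>x y. (f x, f y) \<in> le2 Q \<longleftrightarrow> (x, y) \<in> le2 P"
  shows "\<exists>e'. dp_embeds N P e'"
proof -
  have "\<forall>n. \<exists>p. n \<in> verts N \<longrightarrow> p \<in> verts P \<and> e n = f p"
    using sub by blast
  then obtain e' where e': "\<And>n. n \<in> verts N \<Longrightarrow> e' n \<in> verts P \<and> e n = f (e' n)"
    by metis
  have "dp_embeds N P e'"
    unfolding dp_embeds_def
  proof (intro conjI ballI)
    show "inj_on e' (verts N)"
      using e e' unfolding dp_embeds_def inj_on_def by metis
    show "e' ` verts N \<subseteq> verts P" using e' by blast
    fix x y assume "x \<in> verts N" "y \<in> verts N"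
    then show "((x, y) \<in> le1 N) = ((e' x, e' y) \<in> le1 P)" "((x, y) \<in> le2 N) = ((e' x, e' y) \<in> le2 P)"
      using e e' le unfolding dp_embeds_def by simp_all
  qed
  then show ?thesis by blast
qed

lemma double_poset_image:
  assumes "inj f" "double_poset P" shows "double_poset (dp_image f P)"
proof -
  have "partial_order_on (f ` verts P) (map_prod f f ` r)"
    if "partial_order_on (verts P) r" for r
  proof -
    have "map_prod f f ` r \<subseteq> f ` verts P \<times> f ` verts P" "refl_on (f ` verts P) (map_prod f f ` r)"
      using partial_order_onD[OF that] by (auto simp: refl_on_def)
    moreover have "antisym (map_prod f f ` r)"
      using partial_order_onD(3)[OF that] assms(1) by (auto simp: antisym_def inj_eq)
    moreover have "trans (map_prod f f ` r)"
    proof (rule transI)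
      fix x y z assume "(x, y) \<in> map_prod f f ` r" "(y, z) \<in> map_prod f f ` r"
      then obtain a b c where "x = f a" "y = f b" "z = f c" "(a, b) \<in> r" "(b, c) \<in> r"
        using assms(1) by (auto simp: inj_eq)
      then show "(x, z) \<in> map_prod f f ` r"
        using partial_order_onD(2)[OF that] assms(1) by (auto simp: map_prod_image_iff dest: transD)
    qed
    ultimately show ?thesis by (simp add: partial_order_on_def preorder_on_def)
  qed
  then show ?thesis using assms(2) by (auto simp: double_poset_def)
qed

lemma plane_poset_image:
  assumes "inj f" "plane_poset P" shows "plane_poset (dp_image f P)"
  using assms double_poset_image[of f P]
  by (auto simp: plane_poset_def comparable_def map_prod_image_iff)

lemma wn_poset_image:
  assumes "inj f" "wn_poset P" shows "wn_poset (dp_image f P)"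
proof -
  have "\<exists>e'. dp_embeds N P e'" if "dp_embeds N (dp_image f P) e" for N :: "nat dposet" and e
    using that by (rule dp_embeds_factor[of _ _ _ f])
      (use that assms(1) in \<open>auto simp: dp_embeds_def map_prod_image_iff\<close>)
  then show ?thesis
    using assms plane_poset_image unfolding wn_poset_iff_embeds by blast
qed

lemma double_poset_products:
  assumes "double_poset P" "double_poset Q"
  shows "double_poset (dp_leadsto P Q)" "double_poset (dp_natural P Q)"
proof -
  have 1: "partial_order_on (A <+> B) (sum_rel r s)" (is "partial_order_on _ ?R")
    if r: "partial_order_on A r" and s: "partial_order_on B s"
    for A :: "'a set" and B :: "'b set" and r s
  proof -
    note D = partial_order_onD[OF r] partial_order_onD[OF s]
    have mem: "x \<in> A" "y \<in> A" if "(x, y) \<in> r" for x y using D(4) that by auto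
    have mem': "x \<in> B" "y \<in> B" if "(x, y) \<in> s" for x y using D(8) that by auto
    have "?R \<subseteq> (A <+> B) \<times> (A <+> B)"
      using D(4,8) by (auto simp: sum_rel_def)
    moreover have "refl_on (A <+> B) ?R"
      using D(1,5) by (simp add: refl_on_def Ball_def split_sum_all)
    moreover have "antisym ?R"
      using D(3,7) by (simp add: antisym_def split_sum_all image_iff)
    moreover have "trans ?R"
      using D(2,6) by (auto simp: trans_def split_sum_all image_iff intro: mem mem')
    ultimately show ?thesis by (simp add: partial_order_on_def preorder_on_def)
  qed
  have 2: "partial_order_on (A <+> B) (sum_rel r s \<union> (Inl ` A) \<times> (Inr ` B))" (is "partial_order_on _ ?R")
    if r: "partial_order_on A r" and s: "partial_order_on B s"
    for A :: "'a set" and B :: "'b set" and r s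
  proof -
    note D = partial_order_onD[OF r] partial_order_onD[OF s]
    have mem: "x \<in> A" "y \<in> A" if "(x, y) \<in> r" for x y using D(4) that by auto
    have mem': "x \<in> B" "y \<in> B" if "(x, y) \<in> s" for x y using D(8) that by auto
    have "?R \<subseteq> (A <+> B) \<times> (A <+> B)"
      using D(4,8) by (auto simp: sum_rel_def)
    moreover have "refl_on (A <+> B) ?R"
      using D(1,5) by (simp add: refl_on_def Ball_def split_sum_all)
    moreover have "antisym ?R"
      using D(3,7) by (simp add: antisym_def split_sum_all image_iff)
    moreover have "trans ?R"
      using D(2,6) by (auto simp: trans_def split_sum_all image_iff intro: mem mem')
    ultimately show ?thesis by (simp add: partial_order_on_def preorder_on_def)
  qed
  show "double_poset (dp_leadsto P Q)" "double_poset (dp_natural P Q)"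
    using assms 1 2 by (auto simp: double_poset_def)
qed

lemma plane_poset_products:
  assumes "plane_poset P" "plane_poset Q"
  shows "plane_poset (dp_leadsto P Q)" "plane_poset (dp_natural P Q)"
  using assms double_poset_products[of P Q]
  by (simp_all add: plane_poset_def comparable_def Ball_def split_sum_all image_iff)

lemma same_side:
  assumes "(x, y) \<in> sum_rel r s" shows "isl x = isl y"
  using assms by (auto simp: sum_rel_def)

lemma N_embeds_products:
  assumes N: "N = N1 \<or> N = N2"
    and R: "R = dp_leadsto P Q \<or> R = dp_natural P Q"
    and e: "dp_embeds N R e"
  shows "(\<exists>e'. dp_embeds N P e') \<or> (\<exists>e'. dp_embeds N Q e')"
proof -
  have V: "verts N = {0, 1, 2, 3}" using N by (auto simp: N1_def N2_def)
  obtain r where r: "r = le1 N \<or> r = le2 N"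
    and side: "\<And>x y. x \<in> verts N \<Longrightarrow> y \<in> verts N \<Longrightarrow> (x, y) \<in> r \<Longrightarrow> isl (e x) = isl (e y)"
  proof (cases "R = dp_leadsto P Q")
    case True
    then show ?thesis
      using e by (intro that[of "le1 N"]) (simp_all add: dp_embeds_def, metis same_side)
  next
    case False
    then have "R = dp_natural P Q" using R by simp
    then show ?thesis
      using e by (intro that[of "le2 N"]) (simp_all add: dp_embeds_def, metis same_side)
  qed
  have "isl (e 1) = isl (e 0) \<and> isl (e 2) = isl (e 0) \<and> isl (e 3) = isl (e 0)"
    using N r side[of 0 1] side[of 0 2] side[of 0 3] side[of 1 2] side[of 1 3] side[of 2 1]
      side[of 2 3] unfolding V
    by (elim disjE) (simp_all add: N1_def N2_def)
  then have eq: "isl (e n) = isl (e 0)" if "n \<in> verts N" for n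
    using that unfolding V by auto
  have mem: "e n \<in> verts P <+> verts Q" if "n \<in> verts N" for n
    using R e that unfolding dp_embeds_def by auto
  have "e ` verts N \<subseteq> Inl ` verts P \<or> e ` verts N \<subseteq> Inr ` verts Q"
  proof (cases "isl (e 0)")
    case True
    then have "e n \<in> Inl ` verts P" if "n \<in> verts N" for n
      using eq[OF that] mem[OF that] by (cases "e n") simp_all
    then show ?thesis by blast
  next
    case False
    then have "e n \<in> Inr ` verts Q" if "n \<in> verts N" for n
      using eq[OF that] mem[OF that] by (cases "e n") simp_all
    then show ?thesis by blast
  qed
  moreover have ?thesis if "e ` verts N \<subseteq> Inl ` verts P"
    using dp_embeds_factor[OF e that] R by (elim disjE) (simp_all add: image_iff)
  moreover have ?thesis if "e ` verts N \<subseteq> Inr ` verts Q"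
    using dp_embeds_factor[OF e that] R by (elim disjE) (simp_all add: image_iff)
  ultimately show ?thesis by blast
qed

lemma wn_poset_products:
  assumes "wn_poset P" "wn_poset Q"
  shows "wn_poset (dp_leadsto P Q)" "wn_poset (dp_natural P Q)"
  using assms plane_poset_products[of P Q]
    N_embeds_products[of N1 "dp_leadsto P Q" P Q] N_embeds_products[of N2 "dp_leadsto P Q" P Q]
    N_embeds_products[of N1 "dp_natural P Q" P Q] N_embeds_products[of N2 "dp_natural P Q" P Q]
  unfolding wn_poset_iff_embeds by blast+

lemma dp_iso_products:
  assumes "dp_iso P P'" "dp_iso Q Q'"
  shows "dp_iso (dp_leadsto P Q) (dp_leadsto P' Q')" "dp_iso (dp_natural P Q) (dp_natural P' Q')"
proof -
  obtain f where f: "bij_betw f (verts P) (verts P')"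
    "\<And>x y. x \<in> verts P \<Longrightarrow> y \<in> verts P \<Longrightarrow>
        ((x, y) \<in> le1 P \<longleftrightarrow> (f x, f y) \<in> le1 P') \<and>
        ((x, y) \<in> le2 P \<longleftrightarrow> (f x, f y) \<in> le2 P')"
    using assms(1) unfolding dp_iso_def by blast
  obtain g where g: "bij_betw g (verts Q) (verts Q')"
    "\<And>x y. x \<in> verts Q \<Longrightarrow> y \<in> verts Q \<Longrightarrow>
        ((x, y) \<in> le1 Q \<longleftrightarrow> (g x, g y) \<in> le1 Q') \<and>
        ((x, y) \<in> le2 Q \<longleftrightarrow> (g x, g y) \<in> le2 Q')"
    using assms(2) unfolding dp_iso_def by blast
  have mem: "f x \<in> verts P'" if "x \<in> verts P" for x
    using f(1) that by (auto simp: bij_betw_def)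
  have mem': "g x \<in> verts Q'" if "x \<in> verts Q" for x
    using g(1) that by (auto simp: bij_betw_def)
  have b: "bij_betw (map_sum f g) (verts P <+> verts Q) (verts P' <+> verts Q')"
  proof (rule bij_betw_imageI)
    show "inj_on (map_sum f g) (verts P <+> verts Q)"
      using f(1) g(1) unfolding bij_betw_def inj_on_def Ball_def split_sum_all by simp
    have "map_sum f g ` (verts P <+> verts Q) = f ` verts P <+> g ` verts Q"
      by (simp add: Plus_def image_Un image_image)
    then show "map_sum f g ` (verts P <+> verts Q) = verts P' <+> verts Q'"
      using f(1) g(1) by (simp add: bij_betw_def)
  qed
  show "dp_iso (dp_leadsto P Q) (dp_leadsto P' Q')"
    unfolding dp_iso_def
  proof (intro exI[of _ "map_sum f g"] conjI ballI)
    show "bij_betw (map_sum f g) (verts (dp_leadsto P Q)) (verts (dp_leadsto P' Q'))" using b by simp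
    fix x y assume xy: "x \<in> verts (dp_leadsto P Q)" "y \<in> verts (dp_leadsto P Q)"
    show "((x, y) \<in> le1 (dp_leadsto P Q)) = ((map_sum f g x, map_sum f g y) \<in> le1 (dp_leadsto P' Q'))"
      "((x, y) \<in> le2 (dp_leadsto P Q)) = ((map_sum f g x, map_sum f g y) \<in> le2 (dp_leadsto P' Q'))"
      using xy f(2) g(2) mem mem' by (cases x; cases y; simp add: image_iff)+
  qed
  show "dp_iso (dp_natural P Q) (dp_natural P' Q')"
    unfolding dp_iso_def
  proof (intro exI[of _ "map_sum f g"] conjI ballI)
    show "bij_betw (map_sum f g) (verts (dp_natural P Q)) (verts (dp_natural P' Q'))" using b by simp
    fix x y assume xy: "x \<in> verts (dp_natural P Q)" "y \<in> verts (dp_natural P Q)"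
    show "((x, y) \<in> le1 (dp_natural P Q)) = ((map_sum f g x, map_sum f g y) \<in> le1 (dp_natural P' Q'))"
      "((x, y) \<in> le2 (dp_natural P Q)) = ((map_sum f g x, map_sum f g y) \<in> le2 (dp_natural P' Q'))"
      using xy f(2) g(2) mem mem' by (cases x; cases y; simp add: image_iff)+
  qed
qed


section \<open>Isomorphism classes of WN posets\<close>

text \<open>Every finite double poset is isomorphic to one whose points are natural numbers, so the
  isomorphism classes are represented by posets on finite subsets of \<^typ>\<open>nat\<close>. Disjoint
  unions are brought back to \<^typ>\<open>nat\<close> by the bijection \<^const>\<open>sum_encode\<close>.\<close>

definition wn_equiv :: "nat dposet \<Rightarrow> nat dposet \<Rightarrow> bool" where
  "wn_equiv P Q \<longleftrightarrow> wn_poset P \<and> wn_poset Q \<and> dp_iso P Q"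

lemma wn_poset_empty: "wn_poset (DPoset {} {} {})"
  by (auto simp: wn_poset_iff_embeds plane_poset_def double_poset_def dp_embeds_def N1_def N2_def)

lemma wn_poset_point: "wn_poset (DPoset {x} {(x, x)} {(x, x)})"
  by (auto simp: wn_poset_iff_embeds plane_poset_def double_poset_def dp_embeds_def N1_def N2_def
      partial_order_on_def preorder_on_def refl_on_def trans_def antisym_def)

quotient_type wnp = "nat dposet" / partial: wn_equiv
proof (rule part_equivpI)
  show "\<exists>P. wn_equiv P P"
    using wn_poset_empty dp_iso_refl unfolding wn_equiv_def by blast
  show "symp wn_equiv"
    unfolding wn_equiv_def using dp_iso_sym by (auto intro: sympI)
  show "transp wn_equiv"
    unfolding wn_equiv_def using dp_iso_trans by (auto intro!: transpI)
qed

lemma wn_equiv_encode: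
  assumes "wn_poset R" "wn_poset R'" "dp_iso R R'"
  shows "wn_equiv (dp_image sum_encode R) (dp_image sum_encode R')"
  using assms wn_poset_image[OF inj_sum_encode] dp_iso_image[OF inj_sum_encode]
    dp_iso_sym dp_iso_trans
  unfolding wn_equiv_def by meson

lift_definition wnp_leadsto :: "wnp \<Rightarrow> wnp \<Rightarrow> wnp"
  is "\<lambda>P Q. dp_image sum_encode (dp_leadsto P Q)"
  by (rule wn_equiv_encode) (auto simp: wn_equiv_def wn_poset_products dp_iso_products)

lift_definition wnp_natural :: "wnp \<Rightarrow> wnp \<Rightarrow> wnp"
  is "\<lambda>P Q. dp_image sum_encode (dp_natural P Q)"
  by (rule wn_equiv_encode) (auto simp: wn_equiv_def wn_poset_products dp_iso_products)

lift_definition wnp_empty :: wnp is "DPoset {} {} {}"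
  by (simp add: wn_equiv_def wn_poset_empty dp_iso_refl)

lift_definition wnp_point :: wnp is "DPoset {0} {(0, 0)} {(0, 0)}"
  by (simp add: wn_equiv_def wn_poset_point dp_iso_refl)


section \<open>The space with basis the WN posets\<close>

type_synonym 'k hwnp = "wnp \<Rightarrow>\<^sub>0 'k"

definition hwnp_scale :: "'k::field \<Rightarrow> 'k hwnp \<Rightarrow> 'k hwnp" where
  "hwnp_scale c p = Poly_Mapping.map ((*) c) p"

definition bilinear_ext :: "(wnp \<Rightarrow> wnp \<Rightarrow> wnp) \<Rightarrow> 'k::field hwnp \<Rightarrow> 'k hwnp \<Rightarrow> 'k hwnp" where
  "bilinear_ext m p q = (\<Sum>x\<in>Poly_Mapping.keys p. \<Sum>y\<in>Poly_Mapping.keys q.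
     Poly_Mapping.single (m x y) (Poly_Mapping.lookup p x * Poly_Mapping.lookup q y))"

definition hwnp_leadsto :: "'k::field hwnp \<Rightarrow> 'k hwnp \<Rightarrow> 'k hwnp" where
  "hwnp_leadsto = bilinear_ext wnp_leadsto"

definition hwnp_natural :: "'k::field hwnp \<Rightarrow> 'k hwnp \<Rightarrow> 'k hwnp" where
  "hwnp_natural = bilinear_ext wnp_natural"

definition hwnp_unit :: "'k::field hwnp" where
  "hwnp_unit = Poly_Mapping.single wnp_empty 1"

definition hwnp_point :: "'k::field hwnp" where
  "hwnp_point = Poly_Mapping.single wnp_point 1"


section \<open>2-As algebras\<close>

locale two_as_algebra = vector_space scale
  for scale :: "'k::field \<Rightarrow> 'v::ab_group_add \<Rightarrow> 'v" +
  fixes m1 m2 :: "'v \<Rightarrow> 'v \<Rightarrow> 'v" and u :: 'v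
  assumes m1_linear_right: "Vector_Spaces.linear scale scale (\<lambda>y. m1 x y)"
    and m1_linear_left: "Vector_Spaces.linear scale scale (\<lambda>x. m1 x y)"
    and m2_linear_right: "Vector_Spaces.linear scale scale (\<lambda>y. m2 x y)"
    and m2_linear_left: "Vector_Spaces.linear scale scale (\<lambda>x. m2 x y)"
    and m1_assoc: "m1 (m1 x y) z = m1 x (m1 y z)"
    and m2_assoc: "m2 (m2 x y) z = m2 x (m2 y z)"
    and m1_unit: "m1 u x = x" "m1 x u = x"
    and m2_unit: "m2 u x = x" "m2 x u = x"

definition two_as_hom ::
  "('k::field \<Rightarrow> 'v::ab_group_add \<Rightarrow> 'v) \<Rightarrow> ('v \<Rightarrow> 'v \<Rightarrow> 'v) \<Rightarrow> ('v \<Rightarrow> 'v \<Rightarrow> 'v) \<Rightarrow> 'v \<Rightarrow>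
   ('k \<Rightarrow> 'w::ab_group_add \<Rightarrow> 'w) \<Rightarrow> ('w \<Rightarrow> 'w \<Rightarrow> 'w) \<Rightarrow> ('w \<Rightarrow> 'w \<Rightarrow> 'w) \<Rightarrow> 'w \<Rightarrow>
   ('v \<Rightarrow> 'w) \<Rightarrow> bool" where
  "two_as_hom s m1 m2 u s' m1' m2' u' f \<longleftrightarrow>
     Vector_Spaces.linear s s' f \<and>
     (\<forall>x y. f (m1 x y) = m1' (f x) (f y)) \<and>
     (\<forall>x y. f (m2 x y) = m2' (f x) (f y)) \<and>
     f u = u'"

text \<open>The type argument is the carrier type of the test algebras, over which a definition
  cannot quantify: freeness is the statement for a type variable \<open>'w\<close>, that is, for all types.\<close>

definition freely_generated_by ::
  "'w::ab_group_add itself \<Rightarrow> ('k::field \<Rightarrow> 'v::ab_group_add \<Rightarrow> 'v) \<Rightarrow>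
   ('v \<Rightarrow> 'v \<Rightarrow> 'v) \<Rightarrow> ('v \<Rightarrow> 'v \<Rightarrow> 'v) \<Rightarrow> 'v \<Rightarrow> 'v \<Rightarrow> bool" where
  "freely_generated_by _ s m1 m2 u x \<longleftrightarrow>
     (\<forall>(s' :: 'k \<Rightarrow> 'w \<Rightarrow> 'w) m1' m2' u' a. two_as_algebra s' m1' m2' u' \<longrightarrow>
        (\<exists>!f. two_as_hom s m1 m2 u s' m1' m2' u' f \<and> f x = a))"

end

theory Submission
  imports Defs
begin

text \<open>The two products on the vector space are the bilinear extensions of two monoid products on
  the set of isomorphism classes of WN posets, which share their unit. It therefore suffices to show
  that this set, with its two products, is free on the one-point class: for any set with two
  associative products sharing a unit and any element \<open>a\<close> of it, there is exactly one map that respects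
  the products and the unit and sends the point to \<open>a\<close>. Its linear extension is the required morphism,
  and two morphisms of algebras that agree on the basis are equal.

  Freeness on the set of classes is a unique factorisation statement. A factorisation
  \<open>P = Q \<leadsto> R\<close> is the same as a cut, a subset \<open>A\<close> of \<open>P\<close> all of whose points lie below all points
  outside \<open>A\<close> for the second order; for \<open>\<natural>\<close> the first order is used, and exchanging the two
  orders reduces this case to the other. Three properties of cuts carry the argument.

  \<^item> Every WN poset with at least two points has a proper cut for one of the orders
    (\<open>subset_has_cut\<close>), so the point generates all classes and morphisms are unique. The union of the
    two orders of a plane poset is a total order. Removing its greatest point leaves a poset with a
    cut by induction, and a cut of the whole poset can be read off from it unless the points form one
    of the forbidden patterns.

  \<^item> Cuts for the same order are nested, so two factorisations for the same product have a common
    refinement (\<open>wnp_leadsto_levi\<close>).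

  \<^item> A poset cannot have proper cuts for both orders (\<open>proper_splits_exclusive\<close>), so a class is
    decomposable for at most one product.

  By the last two properties, a map defined by recursion along an arbitrarily chosen factorisation
  does not depend on the choice, hence respects both products.\<close>

section \<open>Cuts of a plane poset\<close>

text \<open>A cut is the left factor in a way of writing \<open>P\<close> as a product
  \<open>Q \<leadsto> R\<close>. Incomparability for the first order is not part of the
  definition: in a plane poset it follows from comparability for the second.\<close>

definition leads_cut :: "'a dposet \<Rightarrow> 'a set \<Rightarrow> bool" where
  "leads_cut P A \<longleftrightarrow> A \<subseteq> verts P \<and> A \<times> (verts P - A) \<subseteq> le2 P"

lemma plane_posetD:
  assumes "plane_poset P"
  shows "finite (verts P)" "partial_order_on (verts P) (le1 P)" "partial_order_on (verts P) (le2 P)"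
    "le1 P \<subseteq> verts P \<times> verts P" "le2 P \<subseteq> verts P \<times> verts P"
    "antisym (le1 P)" "antisym (le2 P)" "trans (le1 P)" "trans (le2 P)"
    "x \<in> verts P \<Longrightarrow> (x, x) \<in> le1 P" "x \<in> verts P \<Longrightarrow> (x, x) \<in> le2 P"
    "x \<in> verts P \<Longrightarrow> y \<in> verts P \<Longrightarrow> x \<noteq> y \<Longrightarrow>
      ((x, y) \<in> le1 P \<or> (y, x) \<in> le1 P) \<longleftrightarrow> \<not> ((x, y) \<in> le2 P \<or> (y, x) \<in> le2 P)"
  using assms
  by (auto simp: plane_poset_def double_poset_def comparable_def dest: partial_order_onD refl_onD)

lemma wn_poset_plane: "wn_poset P \<Longrightarrow> plane_poset P"
  by (simp add: wn_poset_def)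

lemma partial_order_on_subset:
  assumes "partial_order_on V r" "S \<subseteq> V"
  shows "partial_order_on S (r \<inter> S \<times> S)"
  using partial_order_onD[OF assms(1)] assms(2)
  by (auto simp: partial_order_on_def preorder_on_def refl_on_def trans_def antisym_def)

lemma wn_poset_subposet:
  assumes "wn_poset P" "S \<subseteq> verts P"
  shows "wn_poset (subposet P S)"
proof -
  have "dp_embeds N P e" if "dp_embeds N (subposet P S) e" for N :: "nat dposet" and e
    using that assms(2) by (auto simp: dp_embeds_def)
  moreover have "plane_poset (subposet P S)"
    using assms by (auto simp: wn_poset_def plane_poset_def double_poset_def comparable_def subset_iff
        intro: partial_order_on_subset finite_subset)
  ultimately show ?thesis
    using assms(1) unfolding wn_poset_iff_embeds by blast
qed

lemma subposet_subposet [simp]: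
  "T \<subseteq> S \<Longrightarrow> subposet (subposet P S) T = subposet P T"
  by (auto simp: subposet_def)

lemma subposet_verts [simp]: "plane_poset P \<Longrightarrow> subposet P (verts P) = P"
  using plane_posetD(4,5)[of P] by (cases P) (auto simp: subposet_def)

lemma dp_iso_cut:
  assumes P: "plane_poset P" and A: "leads_cut P A"
  shows "dp_iso (dp_leadsto (subposet P A) (subposet P (verts P - A))) P"
  unfolding dp_iso_def
proof (intro exI[of _ "case_sum id id"] conjI ballI)
  note D = plane_posetD[OF P]
  have sub: "A \<subseteq> verts P" and le: "\<And>a b. a \<in> A \<Longrightarrow> b \<in> verts P - A \<Longrightarrow> (a, b) \<in> le2 P"
    using A by (auto simp: leads_cut_def)
  show "bij_betw (case_sum id id) (verts (dp_leadsto (subposet P A) (subposet P (verts P - A)))) (verts P)"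
    using sub by (auto simp: bij_betw_def inj_on_def image_Un Plus_def image_image)
  have no: "(b, a) \<notin> le2 P" "(a, b) \<notin> le1 P" "(b, a) \<notin> le1 P"
    if "a \<in> A" "b \<in> verts P" "b \<notin> A" for a b
    using le[of a b] that sub D(7) D(12)[of a b] by (auto dest: antisymD)
  fix x y
  assume "x \<in> verts (dp_leadsto (subposet P A) (subposet P (verts P - A)))"
    "y \<in> verts (dp_leadsto (subposet P A) (subposet P (verts P - A)))"
  then show "((x, y) \<in> le1 (dp_leadsto (subposet P A) (subposet P (verts P - A)))) =
        ((case_sum id id x, case_sum id id y) \<in> le1 P)"
    "((x, y) \<in> le2 (dp_leadsto (subposet P A) (subposet P (verts P - A)))) =
        ((case_sum id id x, case_sum id id y) \<in> le2 P)"
    using le no by (cases x; cases y; auto)+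
qed

lemma dp_iso_subposet_image:
  assumes "inj_on g (verts T)"
    and "\<And>x y. x \<in> verts T \<Longrightarrow> y \<in> verts T \<Longrightarrow>
      ((x, y) \<in> le1 T \<longleftrightarrow> (g x, g y) \<in> le1 P) \<and> ((x, y) \<in> le2 T \<longleftrightarrow> (g x, g y) \<in> le2 P)"
  shows "dp_iso T (subposet P (g ` verts T))"
  unfolding dp_iso_def using assms by (intro exI[of _ g]) (simp add: bij_betw_def)

lemma cut_of_dp_iso:
  assumes "dp_iso (dp_leadsto Q R) P"
  obtains A where "leads_cut P A" "dp_iso Q (subposet P A)" "dp_iso R (subposet P (verts P - A))"
proof -
  obtain f where f: "bij_betw f (verts Q <+> verts R) (verts P)"
    and le: "\<And>x y. x \<in> verts Q <+> verts R \<Longrightarrow> y \<in> verts Q <+> verts R \<Longrightarrow>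
        ((x, y) \<in> le1 (dp_leadsto Q R) \<longleftrightarrow> (f x, f y) \<in> le1 P) \<and>
        ((x, y) \<in> le2 (dp_leadsto Q R) \<longleftrightarrow> (f x, f y) \<in> le2 P)"
    using assms unfolding dp_iso_def by auto
  let ?A = "(f \<circ> Inl) ` verts Q" and ?B = "(f \<circ> Inr) ` verts R"
  have "verts P = ?A \<union> ?B"
    using f by (simp add: bij_betw_def Plus_def image_Un image_comp)
  moreover have "?A \<inter> ?B = {}"
    using f by (auto simp: bij_betw_def inj_on_def)
  ultimately have B: "verts P - ?A = ?B" "?A \<subseteq> verts P" by auto
  have inj: "inj_on (f \<circ> Inl) (verts Q)" "inj_on (f \<circ> Inr) (verts R)"
    using f by (auto simp: bij_betw_def inj_on_def)
  show thesis
  proof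
    have "(f (Inl x), f (Inr y)) \<in> le2 P" if "x \<in> verts Q" "y \<in> verts R" for x y
      using le[of "Inl x" "Inr y"] that by simp
    then show "leads_cut P ?A"
      unfolding leads_cut_def B using B(2) by auto
    show "dp_iso Q (subposet P ?A)"
    proof (rule dp_iso_subposet_image[OF inj(1)])
      fix x y assume "x \<in> verts Q" "y \<in> verts Q"
      then show "((x, y) \<in> le1 Q \<longleftrightarrow> ((f \<circ> Inl) x, (f \<circ> Inl) y) \<in> le1 P) \<and>
          ((x, y) \<in> le2 Q \<longleftrightarrow> ((f \<circ> Inl) x, (f \<circ> Inl) y) \<in> le2 P)"
        using le[of "Inl x" "Inl y"] by (simp add: image_iff)
    qed
    show "dp_iso R (subposet P (verts P - ?A))"
      unfolding B
    proof (rule dp_iso_subposet_image[OF inj(2)])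
      fix x y assume "x \<in> verts R" "y \<in> verts R"
      then show "((x, y) \<in> le1 R \<longleftrightarrow> ((f \<circ> Inr) x, (f \<circ> Inr) y) \<in> le1 P) \<and>
          ((x, y) \<in> le2 R \<longleftrightarrow> ((f \<circ> Inr) x, (f \<circ> Inr) y) \<in> le2 P)"
        using le[of "Inr x" "Inr y"] by (simp add: image_iff)
    qed
  qed
qed

section \<open>Exchanging the two orders\<close>

definition dp_swap :: "'a dposet \<Rightarrow> 'a dposet" where
  "dp_swap P = DPoset (verts P) (le2 P) (le1 P)"

lemma dp_swap_simps [simp]:
  "verts (dp_swap P) = verts P" "le1 (dp_swap P) = le2 P" "le2 (dp_swap P) = le1 P"
  "dp_swap (dp_swap P) = P"
  by (simp_all add: dp_swap_def)

lemma dp_natural_eq_swap: 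
  "dp_image f (dp_natural P Q) = dp_swap (dp_image f (dp_leadsto (dp_swap P) (dp_swap Q)))"
  by (simp add: dp_swap_def dp_image_def)

lemma plane_poset_swap: "plane_poset P \<Longrightarrow> plane_poset (dp_swap P)"
  by (auto simp: plane_poset_def double_poset_def)

text \<open>Embeddings are stated with a second pattern \<open>M\<close> because exchanging the orders
  turns each of the two forbidden posets into (a relabelling of) the other.\<close>

lemma dp_embeds_swap:
  assumes e: "dp_embeds N (dp_swap P) e" and M: "dp_embeds M (dp_swap N) s"
  shows "dp_embeds M P (e \<circ> s)"
proof -
  have s: "s x \<in> verts N" if "x \<in> verts M" for x
    using M that by (auto simp: dp_embeds_def)
  show ?thesis
    unfolding dp_embeds_def
  proof (intro conjI ballI)
    show "inj_on (e \<circ> s) (verts M)"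
      using e M s unfolding dp_embeds_def inj_on_def by simp
    show "(e \<circ> s) ` verts M \<subseteq> verts P"
      using e s by (auto simp: dp_embeds_def)
  next
    fix x y assume "x \<in> verts M" "y \<in> verts M"
    then show "((x, y) \<in> le1 M) = (((e \<circ> s) x, (e \<circ> s) y) \<in> le1 P)"
      "((x, y) \<in> le2 M) = (((e \<circ> s) x, (e \<circ> s) y) \<in> le2 P)"
      using e M s unfolding dp_embeds_def by simp_all
  qed
qed

lemma N_swap:
  "dp_embeds N2 (dp_swap N1) (id(1 := 2, 2 := 1))"
  "dp_embeds N1 (dp_swap N2) (id(1 := 2, 2 := 1))"
  by (simp_all add: dp_embeds_def N1_def N2_def inj_on_def Id_on_iff)

text \<open>Hence WN posets carry an involution under which the two products correspond, and every
  fact about \<open>\<leadsto>\<close> has a counterpart for \<open>\<natural>\<close>.\<close>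

lemma wn_poset_swap: "wn_poset P \<Longrightarrow> wn_poset (dp_swap P)"
  unfolding wn_poset_iff_embeds
  using plane_poset_swap dp_embeds_swap N_swap by blast

lemma dp_iso_swap: "dp_iso P Q \<Longrightarrow> dp_iso (dp_swap P) (dp_swap Q)"
  unfolding dp_iso_def dp_swap_simps by meson

section \<open>A WN poset with several points has a cut\<close>

lemma wn_poset_no_N1:
  assumes P: "wn_poset P"
    and h: "(a, c) \<in> le1 P" "(a, d) \<in> le1 P" "(b, d) \<in> le1 P"
    and r: "(a, b) \<in> le2 P" "(c, b) \<in> le2 P" "(c, d) \<in> le2 P"
    and ne: "a \<noteq> b" "a \<noteq> c" "a \<noteq> d" "b \<noteq> c" "b \<noteq> d" "c \<noteq> d"
  shows False
proof -
  note D = plane_posetD[OF wn_poset_plane[OF P]]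
  have V: "a \<in> verts P" "b \<in> verts P" "c \<in> verts P" "d \<in> verts P"
    using D(4) h by auto
  have not1: "(d, c) \<notin> le2 P" "(d, b) \<notin> le1 P" "(c, b) \<notin> le1 P" "(b, c) \<notin> le1 P"
      "(a, b) \<notin> le1 P" "(b, a) \<notin> le1 P" "(c, d) \<notin> le1 P" "(d, c) \<notin> le1 P"
      "(c, a) \<notin> le1 P" "(d, a) \<notin> le1 P" "(b, a) \<notin> le2 P" "(b, c) \<notin> le2 P"
      "(a, c) \<notin> le2 P" "(c, a) \<notin> le2 P" "(a, d) \<notin> le2 P" "(d, a) \<notin> le2 P"
      "(b, d) \<notin> le2 P" "(d, b) \<notin> le2 P"
    using h r ne V D(12)[of a c] D(12)[of a d] D(12)[of b d] D(12)[of a b] D(12)[of c b] D(12)[of c d]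
      D(6,7) by (auto dest: antisymD)
  have "dp_embeds N1 P ((\<lambda>_. a)(1 := b, 2 := c, 3 := d))"
    unfolding dp_embeds_def N1_def
    using not1 h r ne V D(10,11) by (simp add: inj_on_def Id_on_iff)
  then show False
    using P unfolding wn_poset_iff_embeds by blast
qed

text \<open>In a plane poset the union of the two orders is total, since any two points are comparable
  for exactly one of them. It is also transitive. This needs an argument only when the two given
  relations belong to different orders: if \<open>z\<close> were below \<open>x\<close> for one of the orders, composing with the
  given relation of that order would contradict the other given relation.\<close>

lemma plane_le_trans:
  assumes P: "plane_poset P"
    and xy: "(x, y) \<in> le1 P \<union> le2 P" and yz: "(y, z) \<in> le1 P \<union> le2 P"
  shows "(x, z) \<in> le1 P \<union> le2 P"
proof (cases "x = y \<or> y = z \<or> x = z")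
  case True
  then show ?thesis
    using xy yz plane_posetD[OF P] by auto
next
  case False
  note D = plane_posetD[OF P]
  have V: "x \<in> verts P" "y \<in> verts P" "z \<in> verts P"
    using D(4,5) xy yz by auto
  have "((x, z) \<in> le1 P \<or> (z, x) \<in> le1 P) \<longleftrightarrow> \<not> ((x, z) \<in> le2 P \<or> (z, x) \<in> le2 P)"
    "((x, y) \<in> le1 P \<or> (y, x) \<in> le1 P) \<longleftrightarrow> \<not> ((x, y) \<in> le2 P \<or> (y, x) \<in> le2 P)"
    "((z, y) \<in> le1 P \<or> (y, z) \<in> le1 P) \<longleftrightarrow> \<not> ((z, y) \<in> le2 P \<or> (y, z) \<in> le2 P)"
    using D(12) V False by blast+
  then show ?thesis
    using xy yz False D(6-9) unfolding trans_def antisym_def by blast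
qed

lemma plane_le_max:
  assumes P: "plane_poset P" and S: "finite S" "S \<noteq> {}" "S \<subseteq> verts P"
  shows "\<exists>v\<in>S. \<forall>x\<in>S. (x, v) \<in> le1 P \<union> le2 P"
  using S
proof (induction S rule: finite_ne_induct)
  case (singleton x)
  then show ?case using plane_posetD(10)[OF P] by auto
next
  case (insert w S)
  then obtain v where v: "v \<in> S" "\<And>x. x \<in> S \<Longrightarrow> (x, v) \<in> le1 P \<union> le2 P" by auto
  have w: "(w, w) \<in> le1 P \<union> le2 P"
    using insert.prems plane_posetD(10)[OF P] by auto
  have "v \<noteq> w" "v \<in> verts P" "w \<in> verts P" using v(1) insert by auto
  then have "(v, w) \<in> le1 P \<union> le2 P \<or> (w, v) \<in> le1 P \<union> le2 P"
    using plane_posetD(12)[OF P, of v w] by blast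
  then show ?case
  proof
    assume vw: "(v, w) \<in> le1 P \<union> le2 P"
    then have "(x, w) \<in> le1 P \<union> le2 P" if "x \<in> insert w S" for x
      using that w plane_le_trans[OF P v(2) vw] by auto
    then show ?thesis by blast
  next
    assume "(w, v) \<in> le1 P \<union> le2 P"
    then show ?thesis using v by blast
  qed
qed

text \<open>Adding a point \<open>v\<close> above everything for the total order keeps a cut, possibly another one.
  Suppose \<open>A\<close> cuts \<open>S\<close> for the second order. If some point outside \<open>A\<close> is second-below \<open>v\<close>, so is all of
  \<open>A\<close>, and \<open>A\<close> still works. If \<open>S\<close> lies entirely first-below \<open>v\<close>, then \<open>S\<close> is a cut for the first order.
  In the remaining case the points of \<open>A\<close> that are second-below \<open>v\<close> form a cut, because otherwise a
  copy of \<open>N1\<close> appears.\<close>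

lemma extend_cut:
  assumes P: "wn_poset P" and S: "S \<subseteq> verts P" and v: "v \<notin> S"
    and max: "\<And>x. x \<in> S \<Longrightarrow> (x, v) \<in> le1 P \<union> le2 P"
    and A: "A \<subseteq> S" "A \<noteq> {}" "A \<noteq> S" "A \<times> (S - A) \<subseteq> le2 P"
  shows "\<exists>B\<subseteq>insert v S. B \<noteq> {} \<and> B \<noteq> insert v S \<and>
    (B \<times> (insert v S - B) \<subseteq> le1 P \<or> B \<times> (insert v S - B) \<subseteq> le2 P)"
proof -
  note D = plane_posetD[OF wn_poset_plane[OF P]]
  consider y where "y \<in> S - A" "(y, v) \<in> le2 P" 
    | "\<forall>x\<in>S. (x, v) \<in> le1 P" 
    | x where "x \<in> A" "(x, v) \<in> le2 P" "x \<noteq> v" "\<forall>y\<in>S - A. (y, v) \<in> le1 P" 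
    using max v A(1) by blast
  then show ?thesis
  proof cases
    case 1
    then have "(x, v) \<in> le2 P" if "x \<in> A" for x
      using that A(4) transD[OF D(9), of x y v] by blast
    then show ?thesis
      using A v by (intro exI[of _ A]) auto
  next
    case 2
    then show ?thesis
      using A v by (intro exI[of _ S]) auto
  next
    case 3
    let ?B = "{x\<in>A. (x, v) \<in> le2 P}"
    obtain b where b: "b \<in> S - A" using A by blast
    have "(z, y) \<in> le2 P" if z: "z \<in> ?B" and y: "y \<in> A" "(y, v) \<notin> le2 P" for z y
    proof (rule ccontr)
      assume "(z, y) \<notin> le2 P"
      have yv: "(y, v) \<in> le1 P" using y max A(1) by blast
      have V: "z \<in> verts P" "y \<in> verts P" "z \<noteq> y" "z \<noteq> v" "y \<noteq> v" "b \<noteq> v" "z \<noteq> b" "y \<noteq> b" "v \<in> verts P"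
        using z y A(1) S v b D(4) yv by auto
      have "(y, z) \<notin> le2 P" using y z transD[OF D(9), of y z v] by blast
      moreover have "(z, v) \<notin> le1 P" using V z D(12)[of z v] by blast
      then have "(z, y) \<notin> le1 P" using yv transD[OF D(8), of z y v] by blast
      ultimately have "(y, z) \<in> le1 P"
        using V D(12)[of z y] \<open>(z, y) \<notin> le2 P\<close> by blast
      moreover have "(y, b) \<in> le2 P" "(z, b) \<in> le2 P" "(b, v) \<in> le1 P" 
        using A(4) b y z 3(4) by auto
      \<comment> \<open>The roles of \<open>a, b, c, d\<close> in \<open>N1\<close> are played by \<open>y, b, z, v\<close>.\<close>
      ultimately show False
        using wn_poset_no_N1[OF P, of y z v b] yv z V by auto
    qed
    then have "?B \<times> (insert v S - ?B) \<subseteq> le2 P"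
      using A(4) by blast
    moreover have "?B \<noteq> {}" "?B \<noteq> insert v S" "?B \<subseteq> insert v S"
      using 3 A v by auto
    ultimately show ?thesis by blast
  qed
qed

text \<open>The induction runs over subsets of a fixed poset and removes the greatest point for the
  total order. The induction hypothesis may yield a cut for either order; a cut for the first order
  is extended in the swapped poset, where a copy of \<open>N1\<close> is a copy of \<open>N2\<close> in the original one.\<close>

lemma subset_has_cut:
  assumes P: "wn_poset P" and S: "S \<subseteq> verts P" "2 \<le> card S"
  shows "\<exists>B\<subseteq>S. B \<noteq> {} \<and> B \<noteq> S \<and> (B \<times> (S - B) \<subseteq> le1 P \<or> B \<times> (S - B) \<subseteq> le2 P)"
  using S
proof (induction "card S" arbitrary: S rule: less_induct)
  case less
  note D = plane_posetD[OF wn_poset_plane[OF P]]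
  have fin: "finite S" using D(1) less.prems(1) finite_subset by blast
  obtain v where v: "v \<in> S" "\<And>x. x \<in> S \<Longrightarrow> (x, v) \<in> le1 P \<union> le2 P"
    using plane_le_max[OF wn_poset_plane[OF P] fin _ less.prems(1)] less.prems(2) by fastforce
  let ?S = "S - {v}"
  have ins: "insert v ?S = S" using v by blast
  have c: "card ?S = card S - 1" using v fin by simp
  show ?case
  proof (cases "2 \<le> card ?S")
    case True
    have *: "?S \<subseteq> verts P" "v \<notin> ?S" "\<And>x. x \<in> ?S \<Longrightarrow> (x, v) \<in> le1 P \<union> le2 P"
      "\<And>x. x \<in> ?S \<Longrightarrow> (x, v) \<in> le2 P \<union> le1 P"
      using v less.prems(1) by auto
    obtain A where A: "A \<subseteq> ?S" "A \<noteq> {}" "A \<noteq> ?S" "A \<times> (?S - A) \<subseteq> le1 P \<or> A \<times> (?S - A) \<subseteq> le2 P"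
      using less.hyps[OF _ *(1) True] c less.prems(2) by auto
    from A(4) show ?thesis
    proof
      assume "A \<times> (?S - A) \<subseteq> le2 P"
      from extend_cut[OF P *(1-3) A(1-3) this] show ?thesis unfolding ins .
    next
      assume "A \<times> (?S - A) \<subseteq> le1 P"
      from extend_cut[OF wn_poset_swap[OF P], of ?S v A] * A(1-3) this
      show ?thesis unfolding ins dp_swap_simps by blast
    qed
  next
    case False
    then have "card ?S = 1" using c less.prems(2) by linarith
    then obtain x where x: "?S = {x}" by (rule card_1_singletonE)
    then have "S = {x, v}" "x \<noteq> v" using v by auto
    then show ?thesis
      using v(2)[of x] by (intro exI[of _ "{x}"]) auto
  qed
qed

section \<open>Products of isomorphism classes as cuts\<close>

lemma wnp_cases:
  obtains P where "wn_poset P" "x = abs_wnp P"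
  by (metis Quotient_wnp Quotient_abs_rep Quotient_rep_reflp wn_equiv_def)

lemma abs_wnp_eq_iff:
  "wn_poset P \<Longrightarrow> wn_poset Q \<Longrightarrow> abs_wnp P = abs_wnp Q \<longleftrightarrow> dp_iso P Q"
  using Quotient_rel[OF Quotient_wnp, of P Q] by (auto simp: wn_equiv_def dp_iso_refl)

lemma wnp_leadsto_abs:
  "wn_poset P \<Longrightarrow> wn_poset Q \<Longrightarrow>
    wnp_leadsto (abs_wnp P) (abs_wnp Q) = abs_wnp (dp_image sum_encode (dp_leadsto P Q))"
  by (rule wnp_leadsto.abs_eq) (auto simp: wn_equiv_def dp_iso_refl)

text \<open>Together with the converse \<open>wnp_leadsto_cut_obtain\<close>, this lets equations between products be
  checked on subsets of one representative, without isomorphisms between nested disjoint sums.\<close>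

lemma wnp_leadsto_cut:
  assumes P: "wn_poset P" and S: "S \<subseteq> verts P" and A: "A \<subseteq> S" "A \<times> (S - A) \<subseteq> le2 P"
  shows "abs_wnp (subposet P S) = wnp_leadsto (abs_wnp (subposet P A)) (abs_wnp (subposet P (S - A)))"
proof -
  have wn: "wn_poset (subposet P S)" "wn_poset (subposet P A)" "wn_poset (subposet P (S - A))"
    using P S A(1) by (auto intro!: wn_poset_subposet)
  have "leads_cut (subposet P S) A"
    using A by (auto simp: leads_cut_def)
  from dp_iso_cut[OF wn_poset_plane[OF wn(1)] this]
  have "dp_iso (dp_leadsto (subposet P A) (subposet P (S - A))) (subposet P S)"
    using A(1) by simp
  then have "dp_iso (dp_image sum_encode (dp_leadsto (subposet P A) (subposet P (S - A)))) (subposet P S)"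
    using dp_iso_image[OF inj_sum_encode] dp_iso_sym dp_iso_trans by blast
  then show ?thesis
    using wn by (simp add: wnp_leadsto_abs abs_wnp_eq_iff wn_poset_image inj_sum_encode wn_poset_products
        dp_iso_sym)
qed

lemma wnp_leadsto_cut_obtain:
  assumes P: "wn_poset P" and eq: "abs_wnp P = wnp_leadsto x y"
  obtains A where "leads_cut P A" "x = abs_wnp (subposet P A)" "y = abs_wnp (subposet P (verts P - A))"
proof -
  obtain Q R where Q: "wn_poset Q" "x = abs_wnp Q" and R: "wn_poset R" "y = abs_wnp R"
    by (metis wnp_cases)
  have "dp_iso P (dp_image sum_encode (dp_leadsto Q R))"
    using eq P Q R by (simp add: wnp_leadsto_abs abs_wnp_eq_iff wn_poset_image inj_sum_encode wn_poset_products)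
  then have "dp_iso (dp_leadsto Q R) P"
    using dp_iso_image[OF inj_sum_encode] dp_iso_sym dp_iso_trans by blast
  then obtain A where "leads_cut P A" "dp_iso Q (subposet P A)" "dp_iso R (subposet P (verts P - A))"
    by (rule cut_of_dp_iso)
  then show thesis
    using that[of A] P Q R by (simp add: abs_wnp_eq_iff wn_poset_subposet leads_cut_def)
qed

lift_definition wnp_size :: "wnp \<Rightarrow> nat" is "\<lambda>P. card (verts P)"
  by (auto simp: wn_equiv_def dp_iso_def intro: bij_betw_same_card)

lift_definition wnp_swap :: "wnp \<Rightarrow> wnp" is dp_swap
  by (auto simp: wn_equiv_def wn_poset_swap dp_iso_swap)

lemma wnp_size_abs: "wn_poset P \<Longrightarrow> wnp_size (abs_wnp P) = card (verts P)"
  by (rule wnp_size.abs_eq) (auto simp: wn_equiv_def dp_iso_refl)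

lemma wnp_swap_abs: "wn_poset P \<Longrightarrow> wnp_swap (abs_wnp P) = abs_wnp (dp_swap P)"
  by (rule wnp_swap.abs_eq) (auto simp: wn_equiv_def dp_iso_refl)

lemma wnp_swap_swap [simp]: "wnp_swap (wnp_swap x) = x"
  by (cases x rule: wnp_cases) (simp add: wnp_swap_abs wn_poset_swap)

lemma wnp_size_swap [simp]: "wnp_size (wnp_swap x) = wnp_size x"
  by (cases x rule: wnp_cases) (simp add: wnp_swap_abs wn_poset_swap wnp_size_abs)

lemma wnp_swap_empty [simp]: "wnp_swap wnp_empty = wnp_empty"
  unfolding wnp_empty_def by (simp add: wnp_swap_abs wn_poset_empty) (simp add: dp_swap_def)

lemma wnp_natural_swap:
  "wnp_natural x y = wnp_swap (wnp_leadsto (wnp_swap x) (wnp_swap y))"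
proof (cases x rule: wnp_cases; cases y rule: wnp_cases)
  fix P Q assume *: "wn_poset P" "x = abs_wnp P" "wn_poset Q" "y = abs_wnp Q"
  then have "wnp_natural x y = abs_wnp (dp_image sum_encode (dp_natural P Q))"
    using wnp_natural.abs_eq[of P Q] by (simp add: wn_equiv_def dp_iso_refl)
  with * show ?thesis
    by (simp add: wnp_swap_abs wnp_leadsto_abs wn_poset_swap wn_poset_image inj_sum_encode
        wn_poset_products dp_natural_eq_swap)
qed

lemma wnp_size_eq_0: "wnp_size x = 0 \<longleftrightarrow> x = wnp_empty"
proof (cases x rule: wnp_cases)
  fix P assume *: "wn_poset P" "x = abs_wnp P"
  note D = plane_posetD[OF wn_poset_plane[OF *(1)]]
  have "P = DPoset {} {} {}" if "verts P = {}"
    using that D(4,5) by (cases P) auto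
  then have "wnp_size x = 0 \<Longrightarrow> x = wnp_empty"
    using * D(1) by (simp add: wnp_size_abs wnp_empty_def)
  moreover have "wnp_size wnp_empty = 0"
    by (simp add: wnp_size_abs wnp_empty_def wn_poset_empty)
  ultimately show ?thesis by blast
qed

lemma wnp_size_eq_1: "wnp_size x = 1 \<longleftrightarrow> x = wnp_point"
proof (cases x rule: wnp_cases)
  fix P assume *: "wn_poset P" "x = abs_wnp P"
  note D = plane_posetD[OF wn_poset_plane[OF *(1)]]
  have "x = wnp_point" if "wnp_size x = 1"
  proof -
    have "card (verts P) = 1" using that * by (simp add: wnp_size_abs)
    then obtain a where a: "verts P = {a}" by (rule card_1_singletonE)
    then have "le1 P = {(a, a)}" "le2 P = {(a, a)}"
      using D(4,5) D(10,11)[of a] by auto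
    then have "dp_iso P (DPoset {0} {(0, 0)} {(0, 0)} :: nat dposet)"
      using a unfolding dp_iso_def by (intro exI[of _ "\<lambda>_. 0"]) (auto simp: bij_betw_def)
    then show ?thesis
      using * by (simp add: wnp_point_def abs_wnp_eq_iff wn_poset_point)
  qed
  moreover have "wnp_size wnp_point = 1"
    by (simp add: wnp_size_abs wnp_point_def wn_poset_point)
  ultimately show ?thesis by blast
qed

lemma wnp_size_leadsto: "wnp_size (wnp_leadsto x y) = wnp_size x + wnp_size y"
proof -
  obtain P where P: "wn_poset P" "wnp_leadsto x y = abs_wnp P" by (metis wnp_cases)
  obtain A where A: "leads_cut P A" "x = abs_wnp (subposet P A)" "y = abs_wnp (subposet P (verts P - A))"
    using wnp_leadsto_cut_obtain P by metis
  have "A \<subseteq> verts P" using A(1) by (simp add: leads_cut_def)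
  then show ?thesis
    using P A plane_posetD(1)[OF wn_poset_plane[OF P(1)]]
    by (simp add: wnp_size_abs wn_poset_subposet card_Diff_subset finite_subset card_mono)
qed

lemma wnp_leadsto_assoc: "wnp_leadsto (wnp_leadsto x y) z = wnp_leadsto x (wnp_leadsto y z)"
proof -
  obtain P where P: "wn_poset P" "wnp_leadsto (wnp_leadsto x y) z = abs_wnp P" by (metis wnp_cases)
  obtain A where A: "leads_cut P A" "wnp_leadsto x y = abs_wnp (subposet P A)"
      "z = abs_wnp (subposet P (verts P - A))"
    using wnp_leadsto_cut_obtain P by metis
  have sA: "A \<subseteq> verts P" using A(1) by (simp add: leads_cut_def)
  obtain B where B: "leads_cut (subposet P A) B" "x = abs_wnp (subposet (subposet P A) B)"
      "y = abs_wnp (subposet (subposet P A) (A - B))"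
    using wnp_leadsto_cut_obtain[OF wn_poset_subposet[OF P(1) sA] A(2)[symmetric]] by auto
  have sB: "B \<subseteq> A" using B(1) by (simp add: leads_cut_def)
  have cut: "A \<times> (verts P - A) \<subseteq> le2 P" "B \<times> (A - B) \<subseteq> le2 P"
    using A(1) B(1) by (auto simp: leads_cut_def)
  have diff: "verts P - B - (A - B) = verts P - A"
    using sB by blast
  have total: "B \<times> (verts P - B) \<subseteq> le2 P"
    using cut sA sB by blast
  have "A - B \<subseteq> verts P - B" "(A - B) \<times> (verts P - A) \<subseteq> le2 P"
    using cut(1) sA by blast+
  then have "wnp_leadsto y z = abs_wnp (subposet P (verts P - B))"
    using wnp_leadsto_cut[OF P(1), of "verts P - B" "A - B"] A(3) B(3)
    by (simp add: diff)
  then have "wnp_leadsto x (wnp_leadsto y z) = abs_wnp (subposet P (verts P))"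
    using wnp_leadsto_cut[OF P(1), of "verts P" B, symmetric] total sA sB B(2) by simp
  then show ?thesis
    using P by (simp add: wn_poset_plane)
qed

lemma wnp_leadsto_empty [simp]: "wnp_leadsto wnp_empty x = x" "wnp_leadsto x wnp_empty = x"
proof -
  obtain P where P: "wn_poset P" "x = abs_wnp P" by (metis wnp_cases)
  have "subposet P {} = DPoset {} {} {}" by (simp add: subposet_def)
  then show "wnp_leadsto wnp_empty x = x" "wnp_leadsto x wnp_empty = x"
    using wnp_leadsto_cut[OF P(1), of "verts P" "{}", symmetric] P
      wnp_leadsto_cut[OF P(1), of "verts P" "verts P", symmetric]
    by (simp_all add: wnp_empty_def wn_poset_plane)
qed

text \<open>Two cuts of one poset are nested: a point only in the first and a point only in the second
  would lie below each other. The part between the cuts is the common middle factor. This is the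
  equidivisibility of free monoids (Levi's lemma), and it gives uniqueness of factorisations.\<close>

lemma wnp_leadsto_levi:
  assumes "wnp_leadsto x y = wnp_leadsto x' y'"
  shows "\<exists>r. x = wnp_leadsto x' r \<and> y' = wnp_leadsto r y \<or> x' = wnp_leadsto x r \<and> y = wnp_leadsto r y'"
proof -
  obtain P where P: "wn_poset P" "wnp_leadsto x y = abs_wnp P" by (metis wnp_cases)
  note D = plane_posetD[OF wn_poset_plane[OF P(1)]]
  have main: "\<exists>r. abs_wnp (subposet P B) = wnp_leadsto (abs_wnp (subposet P A)) r \<and>
      abs_wnp (subposet P (verts P - A)) = wnp_leadsto r (abs_wnp (subposet P (verts P - B)))"
    if A: "leads_cut P A" and B: "leads_cut P B" and AB: "A \<subseteq> B" for A B
  proof (intro exI conjI)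
    have le: "A \<times> (B - A) \<subseteq> le2 P" "(B - A) \<times> (verts P - B) \<subseteq> le2 P" "B \<subseteq> verts P"
      using A B by (auto simp: leads_cut_def)
    show "abs_wnp (subposet P B) = wnp_leadsto (abs_wnp (subposet P A)) (abs_wnp (subposet P (B - A)))"
      using wnp_leadsto_cut[OF P(1) le(3) AB le(1)] .
    have "verts P - A - (B - A) = verts P - B" using AB by blast
    then show "abs_wnp (subposet P (verts P - A)) =
        wnp_leadsto (abs_wnp (subposet P (B - A))) (abs_wnp (subposet P (verts P - B)))"
      using wnp_leadsto_cut[OF P(1), of "verts P - A" "B - A"] le by (simp add: Diff_mono)
  qed
  obtain A where A: "leads_cut P A" "x = abs_wnp (subposet P A)" "y = abs_wnp (subposet P (verts P - A))"
    using wnp_leadsto_cut_obtain P by metis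
  obtain B where B: "leads_cut P B" "x' = abs_wnp (subposet P B)" "y' = abs_wnp (subposet P (verts P - B))"
    using wnp_leadsto_cut_obtain P assms by metis
  have "A \<subseteq> B \<or> B \<subseteq> A"
    using A(1) B(1) D(7) unfolding leads_cut_def antisym_def by blast
  then show ?thesis
    using main[OF A(1) B(1)] main[OF B(1) A(1)] A B by blast
qed

lemma wnp_natural_simps:
  "wnp_size (wnp_natural x y) = wnp_size x + wnp_size y"
  "wnp_natural (wnp_natural x y) z = wnp_natural x (wnp_natural y z)"
  "wnp_natural wnp_empty x = x" "wnp_natural x wnp_empty = x"
  by (simp_all add: wnp_natural_swap wnp_size_leadsto wnp_leadsto_assoc)

lemma wnp_natural_levi:
  assumes "wnp_natural x y = wnp_natural x' y'"
  shows "\<exists>r. x = wnp_natural x' r \<and> y' = wnp_natural r y \<or> x' = wnp_natural x r \<and> y = wnp_natural r y'"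
proof -
  have "wnp_leadsto (wnp_swap x) (wnp_swap y) = wnp_leadsto (wnp_swap x') (wnp_swap y')"
    using assms by (metis wnp_natural_swap wnp_swap_swap)
  from wnp_leadsto_levi[OF this] show ?thesis
    by (metis wnp_natural_swap wnp_swap_swap)
qed

section \<open>Proper splits\<close>

definition proper_split :: "(wnp \<Rightarrow> wnp \<Rightarrow> wnp) \<Rightarrow> wnp \<Rightarrow> wnp \<Rightarrow> wnp \<Rightarrow> bool" where
  "proper_split m x y z \<longleftrightarrow> x = m y z \<and> y \<noteq> wnp_empty \<and> z \<noteq> wnp_empty"

lemma proper_split_natural_iff_swap:
  "(\<exists>y z. proper_split wnp_natural x y z) \<longleftrightarrow> (\<exists>y z. proper_split wnp_leadsto (wnp_swap x) y z)"
  unfolding proper_split_def wnp_natural_swap by (metis wnp_swap_swap wnp_swap_empty)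

lemma abs_wnp_subposet_eq_empty:
  assumes "wn_poset P" "S \<subseteq> verts P"
  shows "abs_wnp (subposet P S) = wnp_empty \<longleftrightarrow> S = {}"
proof -
  have "finite S"
    using plane_posetD(1)[OF wn_poset_plane[OF assms(1)]] assms(2) finite_subset by blast
  then show ?thesis
    using assms wnp_size_eq_0[of "abs_wnp (subposet P S)"]
    by (simp add: wnp_size_abs wn_poset_subposet)
qed

lemma proper_split_leadsto_iff:
  assumes P: "wn_poset P"
  shows "(\<exists>y z. proper_split wnp_leadsto (abs_wnp P) y z) \<longleftrightarrow>
    (\<exists>A. leads_cut P A \<and> A \<noteq> {} \<and> A \<noteq> verts P)" (is "?L \<longleftrightarrow> ?R")
proof
  assume ?L
  then obtain y z where eq: "abs_wnp P = wnp_leadsto y z" and ne: "y \<noteq> wnp_empty" "z \<noteq> wnp_empty"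
    unfolding proper_split_def by blast
  from wnp_leadsto_cut_obtain[OF P eq] obtain A where A: "leads_cut P A"
    "y = abs_wnp (subposet P A)" "z = abs_wnp (subposet P (verts P - A))" .
  then show ?R
    using ne P by (auto simp: abs_wnp_subposet_eq_empty leads_cut_def)
next
  assume ?R
  then obtain A where "leads_cut P A" "A \<noteq> {}" "A \<noteq> verts P" by blast
  then show ?L
    unfolding proper_split_def
    using wnp_leadsto_cut[OF P, of "verts P" A] P
    by (intro exI[of _ "abs_wnp (subposet P A)"] exI[of _ "abs_wnp (subposet P (verts P - A))"])
       (auto simp: abs_wnp_subposet_eq_empty leads_cut_def wn_poset_plane)
qed

text \<open>Points on the two sides of a cut for one order are comparable for it and incomparable for
  the other order, so a cut for the other order cannot separate them. Given a proper cut \<open>A\<close> for the second order, any two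
  points of the poset are linked by pairs across \<open>A\<close>, so a cut for the first order contains all points
  or none.\<close>

lemma proper_splits_exclusive:
  assumes "proper_split wnp_leadsto x y z" "proper_split wnp_natural x y' z'"
  shows False
proof -
  obtain P where P: "wn_poset P" "x = abs_wnp P" by (metis wnp_cases)
  note D = plane_posetD[OF wn_poset_plane[OF P(1)]]
  obtain A where A: "leads_cut P A" "A \<noteq> {}" "A \<noteq> verts P"
    using proper_split_leadsto_iff[OF P(1)] assms(1) P(2) by blast
  obtain B where B: "leads_cut (dp_swap P) B" "B \<noteq> {}" "B \<noteq> verts P"
    using proper_split_leadsto_iff[OF wn_poset_swap[OF P(1)]] assms(2) P
      proper_split_natural_iff_swap[of x] wnp_swap_abs[OF P(1)] by auto
  have same: "a \<in> B \<longleftrightarrow> b \<in> B" if "a \<in> A" "b \<in> verts P - A" for a b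
  proof -
    have "(a, b) \<in> le2 P" "a \<in> verts P" "b \<in> verts P" "a \<noteq> b"
      using that A(1) unfolding leads_cut_def by auto
    then have "(a, b) \<notin> le1 P" "(b, a) \<notin> le1 P"
      using D(12)[of a b] by blast+
    then show ?thesis
      using B(1) \<open>a \<in> verts P\<close> \<open>b \<in> verts P\<close> unfolding leads_cut_def by auto
  qed
  have sub: "A \<subseteq> verts P" "B \<subseteq> verts P"
    using A(1) B(1) by (auto simp: leads_cut_def)
  obtain a b where ab: "a \<in> A" "b \<in> verts P - A"
    using A sub by blast
  have "x \<in> B \<longleftrightarrow> a \<in> B" if "x \<in> verts P" for x
    using same[OF ab(1), of x] same[OF _ ab(2), of x] same[OF ab] that by blast
  then show False using B(2,3) sub(2) by blast
qed

lemma proper_split_exists: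
  assumes "x \<noteq> wnp_empty" "x \<noteq> wnp_point"
  shows "(\<exists>y z. proper_split wnp_leadsto x y z) \<or> (\<exists>y z. proper_split wnp_natural x y z)"
proof -
  obtain P where P: "wn_poset P" "x = abs_wnp P" by (metis wnp_cases)
  have "wnp_size x \<noteq> 0" "wnp_size x \<noteq> 1"
    using assms by (simp_all add: wnp_size_eq_0 wnp_size_eq_1[unfolded One_nat_def])
  then have "2 \<le> card (verts P)" using P by (simp add: wnp_size_abs)
  from subset_has_cut[OF P(1) order_refl this]
  have "(\<exists>A. leads_cut P A \<and> A \<noteq> {} \<and> A \<noteq> verts P) \<or> (\<exists>A. leads_cut (dp_swap P) A \<and> A \<noteq> {} \<and> A \<noteq> verts P)"
    unfolding leads_cut_def dp_swap_simps by blast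
  then show ?thesis
    using proper_split_leadsto_iff[OF P(1)] proper_split_leadsto_iff[OF wn_poset_swap[OF P(1)]] P
    by (simp add: proper_split_natural_iff_swap wnp_swap_abs)
qed

section \<open>Freeness of the set of classes with its two products\<close>

lemma proper_split_size:
  assumes "proper_split m x y z" "\<And>y z. wnp_size (m y z) = wnp_size y + wnp_size z"
  shows "wnp_size y < wnp_size x" "wnp_size z < wnp_size x"
  using assms wnp_size_eq_0[of y] wnp_size_eq_0[of z] unfolding proper_split_def by auto

text \<open>When no proper split exists, the choice is an arbitrary pair that is never used.\<close>

definition chosen_split :: "(wnp \<Rightarrow> wnp \<Rightarrow> wnp) \<Rightarrow> wnp \<Rightarrow> wnp \<times> wnp" where
  "chosen_split m x = (SOME p. proper_split m x (fst p) (snd p))"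

lemma proper_split_chosen:
  assumes "\<exists>y z. proper_split m x y z"
  shows "proper_split m x (fst (chosen_split m x)) (snd (chosen_split m x))"
  unfolding chosen_split_def using someI_ex[of "\<lambda>p. proper_split m x (fst p) (snd p)"] assms
  by (metis fst_conv snd_conv)

text \<open>The morphism from the classes to a set with two products \<open>m1\<close>, \<open>m2\<close> and unit \<open>u\<close> that sends
  the point to \<open>a\<close>, computed along one chosen factorisation. Only the empty class and the point have no
  proper split, hence the last line.\<close>

function wnp_fold ::
  "('m \<Rightarrow> 'm \<Rightarrow> 'm) \<Rightarrow> ('m \<Rightarrow> 'm \<Rightarrow> 'm) \<Rightarrow> 'm \<Rightarrow> 'm \<Rightarrow> wnp \<Rightarrow> 'm" where
  "wnp_fold m1 m2 u a x =
    (if \<exists>y z. proper_split wnp_leadsto x y z then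
       m1 (wnp_fold m1 m2 u a (fst (chosen_split wnp_leadsto x)))
          (wnp_fold m1 m2 u a (snd (chosen_split wnp_leadsto x)))
     else if \<exists>y z. proper_split wnp_natural x y z then
       m2 (wnp_fold m1 m2 u a (fst (chosen_split wnp_natural x)))
          (wnp_fold m1 m2 u a (snd (chosen_split wnp_natural x)))
     else if x = wnp_empty then u else a)"
  by auto
termination
proof (relation "measure (\<lambda>(m1, m2, u, a, x). wnp_size x)"; (unfold in_measure prod.case)?)
  fix x
  assume "\<exists>y z. proper_split wnp_leadsto x y z"
  note split = proper_split_size[OF proper_split_chosen[OF this] wnp_size_leadsto]
  show "wnp_size (fst (chosen_split wnp_leadsto x)) < wnp_size x"
    "wnp_size (snd (chosen_split wnp_leadsto x)) < wnp_size x"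
    by (rule split)+
next
  fix x
  assume "\<exists>y z. proper_split wnp_natural x y z"
  note split = proper_split_size[OF proper_split_chosen[OF this] wnp_natural_simps(1)]
  show "wnp_size (fst (chosen_split wnp_natural x)) < wnp_size x"
    "wnp_size (snd (chosen_split wnp_natural x)) < wnp_size x"
    by (rule split)+
qed (rule wf_measure)

declare wnp_fold.simps [simp del]

text \<open>A map that respects one proper factorisation of each class respects all of them. If \<open>y z\<close> is
  the given and \<open>y' z'\<close> the chosen factorisation, Levi's lemma supplies a middle factor \<open>r\<close>, for
  example \<open>y = y' r\<close> and \<open>z' = r z\<close>; both products are smaller, so by induction the two values differ
  only by a reassociation in the target.\<close>

lemma multiplicative_of_splits:
  assumes size: "\<And>y z. wnp_size (op y z) = wnp_size y + wnp_size z"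
    and op_empty: "\<And>x. op wnp_empty x = x" "\<And>x. op x wnp_empty = x"
    and levi: "\<And>x y x' y'. op x y = op x' y' \<Longrightarrow>
      \<exists>r. x = op x' r \<and> y' = op r y \<or> x' = op x r \<and> y = op r y'"
    and m: "\<And>s t v. m (m s t) v = m s (m t v)" "\<And>t. m u t = t" "\<And>t. m t u = t"
    and empty: "\<phi> wnp_empty = u"
    and split: "\<And>x. \<exists>y z. proper_split op x y z \<Longrightarrow>
      \<exists>y z. proper_split op x y z \<and> \<phi> x = m (\<phi> y) (\<phi> z)"
  shows "\<phi> (op y z) = m (\<phi> y) (\<phi> z)"
proof (induction "wnp_size (op y z)" arbitrary: y z rule: less_induct)
  case less
  show ?case
  proof (cases "y = wnp_empty \<or> z = wnp_empty")
    case True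
    then show ?thesis using op_empty m empty by auto
  next
    case False
    then have "proper_split op (op y z) y z" by (simp add: proper_split_def)
    then obtain y' z' where s: "proper_split op (op y z) y' z'" "\<phi> (op y z) = m (\<phi> y') (\<phi> z')"
      using split by blast
    then have eq: "op y z = op y' z'" and ne: "y' \<noteq> wnp_empty" "z' \<noteq> wnp_empty"
      by (simp_all add: proper_split_def)
    have pos: "0 < wnp_size w" if "w \<noteq> wnp_empty" for w
      using that wnp_size_eq_0 by auto
    have sz: "wnp_size y + wnp_size z = wnp_size y' + wnp_size z'"
      using arg_cong[OF eq, of wnp_size] by (simp add: size)
    obtain r where "y = op y' r \<and> z' = op r z \<or> y' = op y r \<and> z = op r z'"
      using levi[OF eq] by blast
    then show ?thesis
    proof
      assume r: "y = op y' r \<and> z' = op r z"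
      then have "\<phi> (op y' r) = m (\<phi> y') (\<phi> r)" "\<phi> (op r z) = m (\<phi> r) (\<phi> z)"
        using less.hyps[of y' r] less.hyps[of r z] pos[of z] pos[of y'] False ne sz by (simp_all add: size)
      then show ?thesis using r s(2) m(1) by simp
    next
      assume r: "y' = op y r \<and> z = op r z'"
      then have "\<phi> (op y r) = m (\<phi> y) (\<phi> r)" "\<phi> (op r z') = m (\<phi> r) (\<phi> z')"
        using less.hyps[of y r] less.hyps[of r z'] pos[of z'] pos[of y] False ne sz by (simp_all add: size)
      then show ?thesis using r s(2) m(1) by simp
    qed
  qed
qed

lemma no_proper_split:
  assumes "\<And>y z. wnp_size (m y z) = wnp_size y + wnp_size z" "x = wnp_empty \<or> x = wnp_point"
  shows "\<not> proper_split m x y z"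
proof
  assume "proper_split m x y z"
  then have "wnp_size x = wnp_size y + wnp_size z" "wnp_size y \<noteq> 0" "wnp_size z \<noteq> 0"
    using assms(1) by (auto simp: proper_split_def wnp_size_eq_0)
  moreover have "wnp_size x \<le> 1"
    using assms(2) wnp_size_eq_0[of x] wnp_size_eq_1[of x] by auto
  ultimately show False by linarith
qed

lemma wnp_point_not_empty: "wnp_point \<noteq> wnp_empty"
  using wnp_size_eq_0[of wnp_point] wnp_size_eq_1[of wnp_point] by auto

lemma wnp_fold_empty: "wnp_fold m1 m2 u a wnp_empty = u"
  and wnp_fold_point: "wnp_fold m1 m2 u a wnp_point = a"
proof -
  have no: "\<not> (\<exists>y z. proper_split wnp_leadsto x y z)" "\<not> (\<exists>y z. proper_split wnp_natural x y z)"
    if "x = wnp_empty \<or> x = wnp_point" for x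
    using no_proper_split[OF wnp_size_leadsto that] no_proper_split[OF wnp_natural_simps(1) that] by blast+
  have val: "wnp_fold m1 m2 u a x = (if x = wnp_empty then u else a)"
    if "x = wnp_empty \<or> x = wnp_point" for x
    by (subst wnp_fold.simps) (simp only: no[OF that] if_False)
  show "wnp_fold m1 m2 u a wnp_empty = u" "wnp_fold m1 m2 u a wnp_point = a"
    using val[of wnp_empty] val[of wnp_point] wnp_point_not_empty by simp_all
qed

lemma wnp_fold_leadsto:
  assumes m: "\<And>s t v. m1 (m1 s t) v = m1 s (m1 t v)" "\<And>t. m1 u t = t" "\<And>t. m1 t u = t"
  shows "wnp_fold m1 m2 u a (wnp_leadsto y z) = m1 (wnp_fold m1 m2 u a y) (wnp_fold m1 m2 u a z)"
proof (rule multiplicative_of_splits[where op = wnp_leadsto and m = m1 and \<phi> = "wnp_fold m1 m2 u a" and u = u,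
      OF wnp_size_leadsto wnp_leadsto_empty wnp_leadsto_levi m wnp_fold_empty])
  fix x assume ex: "\<exists>y z. proper_split wnp_leadsto x y z"
  have "wnp_fold m1 m2 u a x = m1 (wnp_fold m1 m2 u a (fst (chosen_split wnp_leadsto x)))
      (wnp_fold m1 m2 u a (snd (chosen_split wnp_leadsto x)))"
    by (subst wnp_fold.simps) (simp only: ex if_True)
  then show "\<exists>y z. proper_split wnp_leadsto x y z \<and>
      wnp_fold m1 m2 u a x = m1 (wnp_fold m1 m2 u a y) (wnp_fold m1 m2 u a z)"
    using proper_split_chosen[OF ex] by blast
qed

lemma wnp_fold_natural:
  assumes m: "\<And>s t v. m2 (m2 s t) v = m2 s (m2 t v)" "\<And>t. m2 u t = t" "\<And>t. m2 t u = t"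
  shows "wnp_fold m1 m2 u a (wnp_natural y z) = m2 (wnp_fold m1 m2 u a y) (wnp_fold m1 m2 u a z)"
proof (rule multiplicative_of_splits[where op = wnp_natural and m = m2 and \<phi> = "wnp_fold m1 m2 u a" and u = u,
      OF wnp_natural_simps(1,3,4) wnp_natural_levi m wnp_fold_empty])
  fix x assume ex: "\<exists>y z. proper_split wnp_natural x y z"
  then have no: "\<not> (\<exists>y z. proper_split wnp_leadsto x y z)"
    using proper_splits_exclusive by blast
  have "wnp_fold m1 m2 u a x = m2 (wnp_fold m1 m2 u a (fst (chosen_split wnp_natural x)))
      (wnp_fold m1 m2 u a (snd (chosen_split wnp_natural x)))"
    by (subst wnp_fold.simps) (simp only: ex no if_True if_False)
  then show "\<exists>y z. proper_split wnp_natural x y z \<and>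
      wnp_fold m1 m2 u a x = m2 (wnp_fold m1 m2 u a y) (wnp_fold m1 m2 u a z)"
    using proper_split_chosen[OF ex] by blast
qed

text \<open>Every class is generated from the point. This is what makes morphisms unique.\<close>

lemma wnp_induct [case_names empty point leadsto natural]:
  assumes "P wnp_empty" "P wnp_point"
    and "\<And>y z. P y \<Longrightarrow> P z \<Longrightarrow> P (wnp_leadsto y z)"
    and "\<And>y z. P y \<Longrightarrow> P z \<Longrightarrow> P (wnp_natural y z)"
  shows "P x"
proof (induction "wnp_size x" arbitrary: x rule: less_induct)
  case less
  show ?case
  proof (cases "x = wnp_empty \<or> x = wnp_point")
    case True
    then show ?thesis using assms(1,2) by blast
  next
    case False
    then consider y z where "proper_split wnp_leadsto x y z" | y z where "proper_split wnp_natural x y z"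
      using proper_split_exists by blast
    then show ?thesis
    proof cases
      case 1
      then have "P (wnp_leadsto y z)"
        using less proper_split_size[OF 1 wnp_size_leadsto] assms(3) by blast
      then show ?thesis using 1 by (simp add: proper_split_def)
    next
      case 2
      then have "P (wnp_natural y z)"
        using less proper_split_size[OF 2 wnp_natural_simps(1)] assms(4) by blast
      then show ?thesis using 2 by (simp add: proper_split_def)
    qed
  qed
qed

section \<open>Linear and bilinear extension\<close>

abbreviation basis :: "wnp \<Rightarrow> 'k::field hwnp" where
  "basis x \<equiv> Poly_Mapping.single x 1"

lemma lookup_hwnp_scale [simp]:
  "Poly_Mapping.lookup (hwnp_scale c p) x = c * Poly_Mapping.lookup p x"
  by (simp add: hwnp_scale_def Poly_Mapping.map.rep_eq when_def)

lemma hwnp_vector_space: "vector_space (hwnp_scale :: 'k::field \<Rightarrow> 'k hwnp \<Rightarrow> 'k hwnp)"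
  by unfold_locales (auto intro!: poly_mapping_eqI simp: lookup_add algebra_simps)

lemma hwnp_scale_single [simp]:
  "hwnp_scale c (Poly_Mapping.single x d) = Poly_Mapping.single x (c * d)"
  by (rule poly_mapping_eqI) (simp add: lookup_single when_def)

lemma keys_hwnp_scale: "Poly_Mapping.keys (hwnp_scale c p) \<subseteq> Poly_Mapping.keys p"
  by (auto simp: in_keys_iff)

lemma basis_expansion:
  "p = (\<Sum>x\<in>Poly_Mapping.keys p. hwnp_scale (Poly_Mapping.lookup p x) (basis x))"
  by (rule poly_mapping_eqI) (simp add: lookup_sum lookup_single when_def in_keys_iff)

lemma linear_basis_expansion:
  assumes "Vector_Spaces.linear hwnp_scale s f"
  shows "f p = (\<Sum>x\<in>Poly_Mapping.keys p. s (Poly_Mapping.lookup p x) (f (basis x)))"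
proof -
  interpret Vector_Spaces.linear hwnp_scale s f by (fact assms)
  show ?thesis
    by (subst basis_expansion) (simp only: sum scale)
qed

lemma linear_eq_on_basis:
  assumes "Vector_Spaces.linear hwnp_scale s f" "Vector_Spaces.linear hwnp_scale s g"
    and "\<And>x. f (basis x) = g (basis x)"
  shows "f p = g p"
  using assms(3) linear_basis_expansion[OF assms(1), of p] linear_basis_expansion[OF assms(2), of p] by simp

lemma bilinear_eq_on_basis:
  assumes "\<And>q. Vector_Spaces.linear hwnp_scale s (\<lambda>p. f p q)" "\<And>p. Vector_Spaces.linear hwnp_scale s (f p)"
    and "\<And>q. Vector_Spaces.linear hwnp_scale s (\<lambda>p. g p q)" "\<And>p. Vector_Spaces.linear hwnp_scale s (g p)"
    and "\<And>x y. f (basis x) (basis y) = g (basis x) (basis y)"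
  shows "f p q = g p q"
proof (rule linear_eq_on_basis[OF assms(1,3)])
  show "f (basis x) q = g (basis x) q" for x
    by (rule linear_eq_on_basis[OF assms(2,4) assms(5)])
qed

definition linear_ext :: "('k::field \<Rightarrow> 'v \<Rightarrow> 'v) \<Rightarrow> (wnp \<Rightarrow> 'v) \<Rightarrow> 'k hwnp \<Rightarrow> 'v::ab_group_add" where
  "linear_ext s \<phi> p = (\<Sum>x\<in>Poly_Mapping.keys p. s (Poly_Mapping.lookup p x) (\<phi> x))"

lemma linear_ext_superset:
  assumes "vector_space s" "finite A" "Poly_Mapping.keys p \<subseteq> A"
  shows "linear_ext s \<phi> p = (\<Sum>x\<in>A. s (Poly_Mapping.lookup p x) (\<phi> x))"
proof -
  interpret vector_space s by (fact assms(1))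
  show ?thesis
    unfolding linear_ext_def using assms(2,3)
    by (intro sum.mono_neutral_left) (auto simp: in_keys_iff)
qed

lemma linear_linear_ext:
  assumes "vector_space s"
  shows "Vector_Spaces.linear hwnp_scale s (linear_ext s \<phi>)"
proof -
  interpret vector_space s by (fact assms)
  have "linear_ext s \<phi> (p + q) = linear_ext s \<phi> p + linear_ext s \<phi> q" for p q
  proof -
    let ?A = "Poly_Mapping.keys p \<union> Poly_Mapping.keys q"
    have "Poly_Mapping.keys (p + q) \<subseteq> ?A" by (rule Poly_Mapping.keys_add)
    then show ?thesis
      using assms by (simp add: linear_ext_superset[of s ?A] lookup_add scale_left_distrib sum.distrib)
  qed
  moreover have "linear_ext s \<phi> (hwnp_scale c p) = s c (linear_ext s \<phi> p)" for c p
    using linear_ext_superset[OF assms _ keys_hwnp_scale, of p \<phi> c]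
    by (simp add: linear_ext_def scale_sum_right)
  ultimately show ?thesis
    using assms hwnp_vector_space by (simp add: Vector_Spaces.linear_iff)
qed

lemma linear_ext_basis [simp]:
  assumes "vector_space s"
  shows "linear_ext s \<phi> (basis x) = \<phi> x"
proof -
  interpret vector_space s by (fact assms)
  show ?thesis by (simp add: linear_ext_def)
qed

lemma linear_comp:
  assumes "Vector_Spaces.linear s1 s2 f" "Vector_Spaces.linear s2 s3 g"
  shows "Vector_Spaces.linear s1 s3 (\<lambda>x. g (f x))"
  using Vector_Spaces.linear_compose[OF assms] by (simp add: o_def)

text \<open>Reading the bilinear extension as an iterated linear extension gives its linearity in each
  argument.\<close>

lemma bilinear_ext_eq_linear_ext:
  "bilinear_ext m p q = linear_ext hwnp_scale (\<lambda>x. linear_ext hwnp_scale (\<lambda>y. basis (m x y)) q) p"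
proof -
  interpret vector_space "hwnp_scale :: 'a::field \<Rightarrow> _" by (rule hwnp_vector_space)
  show ?thesis
    by (simp add: bilinear_ext_def linear_ext_def scale_sum_right)
qed

lemma bilinear_ext_linear_left: "Vector_Spaces.linear hwnp_scale hwnp_scale (\<lambda>p. bilinear_ext m p q)"
  unfolding bilinear_ext_eq_linear_ext by (rule linear_linear_ext[OF hwnp_vector_space])

lemma bilinear_ext_linear_right: "Vector_Spaces.linear hwnp_scale hwnp_scale (bilinear_ext m p)"
proof -
  interpret vector_space "hwnp_scale :: 'a::field \<Rightarrow> _" by (rule hwnp_vector_space)
  interpret L: Vector_Spaces.linear "hwnp_scale :: 'a \<Rightarrow> _" hwnp_scale "linear_ext hwnp_scale \<phi>" for \<phi>
    by (rule linear_linear_ext[OF hwnp_vector_space])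
  show ?thesis
    unfolding Vector_Spaces.linear_iff bilinear_ext_eq_linear_ext linear_ext_def[of _ _ p]
    by (simp add: hwnp_vector_space L.add L.scale scale_right_distrib sum.distrib scale_sum_right mult.commute)
qed

lemma bilinear_ext_basis [simp]: "bilinear_ext m (basis x) (basis y) = basis (m x y)"
  by (simp add: bilinear_ext_def)

lemma bilinear_ext_assoc:
  assumes "\<And>x y z. m (m x y) z = m x (m y z)"
  shows "bilinear_ext m (bilinear_ext m p q) r = bilinear_ext m p (bilinear_ext m q r)"
proof -
  note lin = bilinear_ext_linear_left bilinear_ext_linear_right
  show ?thesis
  proof (rule bilinear_eq_on_basis[where p = p and q = q])
    fix x y
    show "bilinear_ext m (bilinear_ext m (basis x) (basis y)) r =
        bilinear_ext m (basis x) (bilinear_ext m (basis y) r)"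
      by (rule linear_eq_on_basis[where p = r, OF lin(2) linear_comp[OF lin(2) lin(2)]])
         (simp add: assms)
  qed (rule linear_comp[OF lin(1) lin(1)] linear_comp[OF lin(2) lin(1)] lin(1)
      linear_comp[OF lin(1) lin(2)])+
qed

lemma bilinear_ext_unit:
  assumes "\<And>x. m e x = x" "\<And>x. m x e = x"
  shows "bilinear_ext m (basis e) p = p" "bilinear_ext m p (basis e) = p"
proof -
  have id: "Vector_Spaces.linear hwnp_scale hwnp_scale (\<lambda>p. p)"
    by (simp add: Vector_Spaces.linear_iff hwnp_vector_space)
  show "bilinear_ext m (basis e) p = p"
    by (rule linear_eq_on_basis[OF bilinear_ext_linear_right id]) (simp add: assms)
  show "bilinear_ext m p (basis e) = p"
    by (rule linear_eq_on_basis[OF bilinear_ext_linear_left id]) (simp add: assms)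
qed

lemma hwnp_two_as_algebra:
  "two_as_algebra (hwnp_scale :: 'k::field \<Rightarrow> 'k hwnp \<Rightarrow> 'k hwnp) hwnp_leadsto hwnp_natural hwnp_unit"
  by (intro two_as_algebra.intro two_as_algebra_axioms.intro hwnp_vector_space)
     (simp_all add: hwnp_leadsto_def hwnp_natural_def hwnp_unit_def bilinear_ext_linear_left
        bilinear_ext_linear_right bilinear_ext_assoc bilinear_ext_unit wnp_leadsto_assoc wnp_natural_simps)

lemma linear_ext_multiplicative:
  assumes s: "vector_space s" and m': "\<And>w. Vector_Spaces.linear s s (m' w)" "\<And>w. Vector_Spaces.linear s s (\<lambda>v. m' v w)"
    and \<phi>: "\<And>x y. \<phi> (m x y) = m' (\<phi> x) (\<phi> y)"
  shows "linear_ext s \<phi> (bilinear_ext m p q) = m' (linear_ext s \<phi> p) (linear_ext s \<phi> q)"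
proof -
  note ext = linear_linear_ext[OF s]
  show ?thesis
    by (rule bilinear_eq_on_basis[where p = p and q = q,
          OF linear_comp[OF bilinear_ext_linear_left ext] linear_comp[OF bilinear_ext_linear_right ext]
            linear_comp[OF ext m'(2)] linear_comp[OF ext m'(1)]])
       (simp add: \<phi> s)
qed

theorem theorem24:
  shows "two_as_algebra (hwnp_scale :: 'k::field \<Rightarrow> 'k hwnp \<Rightarrow> 'k hwnp)
           hwnp_leadsto hwnp_natural hwnp_unit \<and>
         freely_generated_by TYPE('a::ab_group_add)
           (hwnp_scale :: 'k \<Rightarrow> 'k hwnp \<Rightarrow> 'k hwnp)
           hwnp_leadsto hwnp_natural hwnp_unit hwnp_point"
  unfolding freely_generated_by_def
proof (intro conjI allI impI hwnp_two_as_algebra)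
  fix s :: "'k \<Rightarrow> 'a \<Rightarrow> 'a" and m1 m2 u a
  assume "two_as_algebra s m1 m2 u"
  then interpret A: two_as_algebra s m1 m2 u .
  let ?\<phi> = "wnp_fold m1 m2 u a"
  have \<phi>_mult: "?\<phi> (wnp_leadsto x y) = m1 (?\<phi> x) (?\<phi> y)"
    "?\<phi> (wnp_natural x y) = m2 (?\<phi> x) (?\<phi> y)" for x y
    by (rule wnp_fold_leadsto wnp_fold_natural;
        rule A.m1_assoc A.m2_assoc A.m1_unit A.m2_unit)+
  show "\<exists>!f. two_as_hom hwnp_scale hwnp_leadsto hwnp_natural hwnp_unit s m1 m2 u f \<and> f hwnp_point = a"
  proof (rule ex1I conjI)+
    show "two_as_hom hwnp_scale hwnp_leadsto hwnp_natural hwnp_unit s m1 m2 u (linear_ext s ?\<phi>)"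
      unfolding two_as_hom_def hwnp_leadsto_def hwnp_natural_def hwnp_unit_def
    proof (intro conjI allI)
      show "Vector_Spaces.linear hwnp_scale s (linear_ext s ?\<phi>)"
        by (rule linear_linear_ext[OF A.vector_space_axioms])
      show "linear_ext s ?\<phi> (bilinear_ext wnp_leadsto p q) = m1 (linear_ext s ?\<phi> p) (linear_ext s ?\<phi> q)" for p q
        by (rule linear_ext_multiplicative[where m = wnp_leadsto and m' = m1 and \<phi> = ?\<phi>,
              OF A.vector_space_axioms A.m1_linear_right A.m1_linear_left \<phi>_mult(1)])
      show "linear_ext s ?\<phi> (bilinear_ext wnp_natural p q) = m2 (linear_ext s ?\<phi> p) (linear_ext s ?\<phi> q)" for p q
        by (rule linear_ext_multiplicative[where m = wnp_natural and m' = m2 and \<phi> = ?\<phi>,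
              OF A.vector_space_axioms A.m2_linear_right A.m2_linear_left \<phi>_mult(2)])
      show "linear_ext s ?\<phi> (basis wnp_empty) = u"
        by (simp add: A.vector_space_axioms wnp_fold_empty)
    qed
    show "linear_ext s ?\<phi> hwnp_point = a"
      by (simp add: hwnp_point_def A.vector_space_axioms wnp_fold_point)
  next
    fix f :: "'k hwnp \<Rightarrow> 'a"
    assume f: "two_as_hom hwnp_scale hwnp_leadsto hwnp_natural hwnp_unit s m1 m2 u f \<and> f hwnp_point = a"
    then have hom: "Vector_Spaces.linear hwnp_scale s f"
      "\<And>p q. f (hwnp_leadsto p q) = m1 (f p) (f q)" "\<And>p q. f (hwnp_natural p q) = m2 (f p) (f q)"
      "f hwnp_unit = u" "f hwnp_point = a"
      by (simp_all add: two_as_hom_def)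
    have on_basis: "f (basis x) = ?\<phi> x" for x
    proof (induction x rule: wnp_induct)
      case (leadsto y z)
      have "f (basis (wnp_leadsto y z)) = m1 (f (basis y)) (f (basis z))"
        using hom(2)[of "basis y" "basis z"] by (simp add: hwnp_leadsto_def)
      then show ?case
        using leadsto \<phi>_mult by simp
    next
      case (natural y z)
      have "f (basis (wnp_natural y z)) = m2 (f (basis y)) (f (basis z))"
        using hom(3)[of "basis y" "basis z"] by (simp add: hwnp_natural_def)
      then show ?case
        using natural \<phi>_mult by simp
    qed (use hom(4,5) in \<open>simp_all add: hwnp_unit_def hwnp_point_def wnp_fold_empty wnp_fold_point\<close>)
    show "f = linear_ext s ?\<phi>"
      by (rule ext, rule linear_eq_on_basis[OF hom(1) linear_linear_ext[OF A.vector_space_axioms]])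
         (simp add: A.vector_space_axioms on_basis)
  qed
qed

end
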